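(* Let $\Omega\subset\mathbb{C}$ be a Jordan region with analytic boundary, $z_0\in\Omega$, $s\in\mathbb{R}$, and let $g,h$ and, for each $N$ for which it is defined, $g^{(N)},h^{(N)}$ be the exact functions and their dipole simulation approximations described in the context. Then there exists a constant $C>0$, independent of $N$, such that for all sufficiently large $N$ $$\|h-h^{(N)}\|_{H^s(\partial\Omega)}\le C\,\|g-g^{(N)}\|_{H^s(\partial\Omega)}.$$
   Context: **Exact functions.** $\Omega$ is a bounded region whose boundary $\partial\Omega$ is an analytic Jordan curve, and $z_0\in\Omega$. Let $f$ be the conformal mapping of $\Omega$ onto the open unit disk with $f(z_0)=0$, $f'(z_0)>0$, written as $f(z)=(z-z_0)\exp[g(z)+\mathrm{i}h(z)]$. Here $g$ is the real harmonic function in $\Omega$ with boundary values $g(z)=-\log|z-z_0|$ on $\partial\Omega$, and $h$ is the conjugate harmonic function of $g$ (i.e. $g+\mathrm{i}h$ is holomorphic in $\Omega$) normalized by $h(z_0)=0$. The functions $g,h$ extend smoothly to $\overline\Omega$. **Peripheral conformal mapping.** For a Jordan curve $\Gamma$ and $\rho>0$, let $\gamma_\rho=\{|z|=\rho\}$. A mapping $\Psi$ from a neighborhood of $\gamma_\rho$ to $\mathbb{C}$ is a peripheral conformal mapping of $\Gamma$ with reference radius $\rho$ if $\Psi$ maps $\gamma_\rho$ onto $\Gamma$ and, for some $\kappa>1$, $\Psi$ is a conformal mapping (holomorphic and injective) on the closed annulus $\{z\in\mathbb{C}\mid\kappa^{-1}\rho\le|z|\le\kappa\rho\}$. **Arrangement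 of points.** Fix a peripheral conformal mapping $\Psi$ of $\partial\Omega$ with reference radius $\rho$ and associated $\kappa$, mapping points with modulus greater than $\rho$ to the exterior of $\overline\Omega$, and fix $R\in(\rho,\sqrt{\kappa}\,\rho)$. With $\omega=\mathrm{e}^{2\pi\mathrm{i}/N}$ put, for $k=1,\dots,N$, $$\zeta_k=\Psi(R\omega^k)\in\mathbb{C}\setminus\overline\Omega,\qquad z_k=\Psi(\rho\omega^k)\in\partial\Omega,\qquad n_k=\frac{\omega^k\Psi'(R\omega^k)}{|\Psi'(R\omega^k)|}$$ (singular points, collocation points, dipole moments). **Dipole simulation approximation.** $g^{(N)}$ is the function $$g^{(N)}(z)=\sum_{k=1}^N Q_k\,\Re\left(\frac{n_k}{z-\zeta_k}\right),\qquad Q_k\in\mathbb{R},$$ with coefficients determined by the collocation equations $g^{(N)}(z_j)=-\log|z_j-z_0|$, $j=1,\dots,N$. It is known that for all sufficiently large $N$ these have a unique solution. Its conjugate harmonic function is $$h^{(N)}(z)=\tilde h^{(N)}(z)-\tilde h^{(N)}(z_0),\qquad \tilde h^{(N)}(z)=\Im\left(\sum_{k=1}^N\frac{Q_kn_k}{z-\zeta_k}\right).$$ **Norms.** For a function $G$ on $\partial\Omega$, let $\Phi(\tau)=\Psi(\rho\mathrm{e}^{2\pi\mathrm{i}\tau})$, $\tau\in\mathbb{R}/\mathbb{Z}$, and let $\hat G(n)$ be the Fourier coefficients of $G\circ\Phi$, i.e. $G(\Phi(\tau))=\sum_{n\in\mathbb{Z}}\hat G(n)\mathrm{e}^{2\pi\mathrm{i}n\tau}$.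 Then $$\|G\|_{H^s(\partial\Omega)}=\Bigl(\sum_{n\in\mathbb{Z}}|\hat G(n)|^2\,\underline{n}^{2s}\Bigr)^{1/2},\qquad \underline{n}=\max\{2\pi|n|,1\}.$$ *)

theory Defs
  imports "HOL-Complex_Analysis.Complex_Analysis"
begin

section \<open>The region and the exact functions\<close>

definition analytic_jordan_curve :: "complex set \<Rightarrow> bool" where
  "analytic_jordan_curve \<Gamma> \<longleftrightarrow>
     (\<exists>\<phi> U. open U \<and> sphere 0 1 \<subseteq> U \<and> \<phi> holomorphic_on U \<and> inj_on \<phi> U \<and>
            \<Gamma> = \<phi> ` sphere 0 1)"

text \<open>Real harmonic functions: twice continuously differentiable with vanishing Laplacian.
  Here \<open>ux\<close>, \<open>uy\<close> are the first and \<open>uxx\<close>, \<open>uxy\<close>, \<open>uyx\<close>, \<open>uyy\<close> the second partial derivatives.\<close>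

definition harmonic_on :: "(complex \<Rightarrow> real) \<Rightarrow> complex set \<Rightarrow> bool" where
  "harmonic_on u S \<longleftrightarrow>
     (\<exists>ux uy uxx uxy uyx uyy.
        (\<forall>z\<in>S. (u has_derivative (\<lambda>w. ux z * Re w + uy z * Im w)) (at z) \<and>
                (ux has_derivative (\<lambda>w. uxx z * Re w + uxy z * Im w)) (at z) \<and>
                (uy has_derivative (\<lambda>w. uyx z * Re w + uyy z * Im w)) (at z) \<and>
                uxx z + uyy z = 0) \<and>
        continuous_on S uxx \<and> continuous_on S uxy \<and>
        continuous_on S uyx \<and> continuous_on S uyy)"

definition normalized_riemann_map ::
    "complex set \<Rightarrow> complex \<Rightarrow> (complex \<Rightarrow> complex) \<Rightarrow> bool" where
  "normalized_riemann_map \<Omega> z0 f \<longleftrightarrow>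
     f holomorphic_on \<Omega> \<and> inj_on f \<Omega> \<and> f ` \<Omega> = ball 0 1 \<and>
     f z0 = 0 \<and> Im (deriv f z0) = 0 \<and> Re (deriv f z0) > 0"

text \<open>The values of \<open>g\<close> and \<open>h\<close> on the boundary are those of their continuous extensions to the
  closure. (The extensions are in fact smooth, but this need not be required.)\<close>

definition exact_functions ::
    "complex set \<Rightarrow> complex \<Rightarrow> (complex \<Rightarrow> complex) \<Rightarrow> (complex \<Rightarrow> real) \<Rightarrow> (complex \<Rightarrow> real) \<Rightarrow> bool" where
  "exact_functions \<Omega> z0 f g h \<longleftrightarrow>
     normalized_riemann_map \<Omega> z0 f \<and>
     (\<forall>z\<in>\<Omega>. f z = (z - z0) * exp (Complex (g z) (h z))) \<and>
     harmonic_on g \<Omega> \<and> continuous_on (closure \<Omega>) g \<and>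
     (\<forall>z\<in>frontier \<Omega>. g z = - ln (cmod (z - z0))) \<and>
     (\<lambda>z. Complex (g z) (h z)) holomorphic_on \<Omega> \<and> continuous_on (closure \<Omega>) h \<and>
     h z0 = 0"


section \<open>Peripheral conformal mappings\<close>

text \<open>\<open>analytic_on\<close> a closed set means holomorphic in some open neighbourhood of it. The values of
  \<open>\<Psi>\<close> outside the annulus are irrelevant.\<close>

definition peripheral_conformal_map ::
    "complex set \<Rightarrow> real \<Rightarrow> real \<Rightarrow> (complex \<Rightarrow> complex) \<Rightarrow> bool" where
  "peripheral_conformal_map \<Gamma> \<rho> \<kappa> \<Psi> \<longleftrightarrow>
     \<rho> > 0 \<and> \<kappa> > 1 \<and> \<Psi> ` sphere 0 \<rho> = \<Gamma> \<and>
     \<Psi> analytic_on {z. \<rho> / \<kappa> \<le> cmod z \<and> cmod z \<le> \<kappa> * \<rho>} \<and>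
     inj_on \<Psi> {z. \<rho> / \<kappa> \<le> cmod z \<and> cmod z \<le> \<kappa> * \<rho>}"


section \<open>The dipole simulation method\<close>

definition root_pt :: "nat \<Rightarrow> nat \<Rightarrow> complex" where
  "root_pt N k = cis (2 * pi / real N) ^ k"

definition singular_pt :: "(complex \<Rightarrow> complex) \<Rightarrow> real \<Rightarrow> nat \<Rightarrow> nat \<Rightarrow> complex" where
  "singular_pt \<Psi> R N k = \<Psi> (of_real R * root_pt N k)"

definition collocation_pt :: "(complex \<Rightarrow> complex) \<Rightarrow> real \<Rightarrow> nat \<Rightarrow> nat \<Rightarrow> complex" where
  "collocation_pt \<Psi> \<rho> N k = \<Psi> (of_real \<rho> * root_pt N k)"

definition dipole_moment :: "(complex \<Rightarrow> complex) \<Rightarrow> real \<Rightarrow> nat \<Rightarrow> nat \<Rightarrow> complex" where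
  "dipole_moment \<Psi> R N k =
     root_pt N k * deriv \<Psi> (of_real R * root_pt N k) /
     of_real (cmod (deriv \<Psi> (of_real R * root_pt N k)))"

definition dipole_g ::
    "(complex \<Rightarrow> complex) \<Rightarrow> real \<Rightarrow> nat \<Rightarrow> (nat \<Rightarrow> real) \<Rightarrow> complex \<Rightarrow> real" where
  "dipole_g \<Psi> R N Q z =
     (\<Sum>k=1..N. Q k * Re (dipole_moment \<Psi> R N k / (z - singular_pt \<Psi> R N k)))"

definition dipole_h_tilde ::
    "(complex \<Rightarrow> complex) \<Rightarrow> real \<Rightarrow> nat \<Rightarrow> (nat \<Rightarrow> real) \<Rightarrow> complex \<Rightarrow> real" where
  "dipole_h_tilde \<Psi> R N Q z =
     Im (\<Sum>k=1..N. of_real (Q k) * dipole_moment \<Psi> R N k / (z - singular_pt \<Psi> R N k))"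

definition dipole_h ::
    "(complex \<Rightarrow> complex) \<Rightarrow> real \<Rightarrow> complex \<Rightarrow> nat \<Rightarrow> (nat \<Rightarrow> real) \<Rightarrow> complex \<Rightarrow> real" where
  "dipole_h \<Psi> R z0 N Q z = dipole_h_tilde \<Psi> R N Q z - dipole_h_tilde \<Psi> R N Q z0"

text \<open>Only the values \<open>Q 1, \<dots>, Q N\<close> of the coefficient function matter.\<close>

definition collocation_eqs ::
    "(complex \<Rightarrow> complex) \<Rightarrow> real \<Rightarrow> real \<Rightarrow> complex \<Rightarrow> nat \<Rightarrow> (nat \<Rightarrow> real) \<Rightarrow> bool" where
  "collocation_eqs \<Psi> \<rho> R z0 N Q \<longleftrightarrow>
     (\<forall>j\<in>{1..N}. dipole_g \<Psi> R N Q (collocation_pt \<Psi> \<rho> N j) =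
                  - ln (cmod (collocation_pt \<Psi> \<rho> N j - z0)))"


section \<open>Sobolev norms on the boundary\<close>

definition boundary_param :: "(complex \<Rightarrow> complex) \<Rightarrow> real \<Rightarrow> real \<Rightarrow> complex" where
  "boundary_param \<Psi> \<rho> \<tau> = \<Psi> (of_real \<rho> * cis (2 * pi * \<tau>))"

definition fourier_coeff ::
    "(complex \<Rightarrow> complex) \<Rightarrow> real \<Rightarrow> (complex \<Rightarrow> real) \<Rightarrow> int \<Rightarrow> complex" where
  "fourier_coeff \<Psi> \<rho> G n =
     integral {0..1} (\<lambda>\<tau>. of_real (G (boundary_param \<Psi> \<rho> \<tau>)) * cis (- 2 * pi * of_int n * \<tau>))"

definition freq_weight :: "int \<Rightarrow> real" where
  "freq_weight n = max (2 * pi * \<bar>of_int n\<bar>) 1"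

text \<open>The norm is extended-valued: it is \<open>\<infinity>\<close> when the defining series diverges (a real-valued
  \<open>infsum\<close> would silently be \<open>0\<close> there).\<close>

definition sobolev_norm ::
    "(complex \<Rightarrow> complex) \<Rightarrow> real \<Rightarrow> real \<Rightarrow> (complex \<Rightarrow> real) \<Rightarrow> ennreal" where
  "sobolev_norm \<Psi> \<rho> s G =
     (let a = (\<lambda>n::int. (cmod (fourier_coeff \<Psi> \<rho> G n))\<^sup>2 * freq_weight n powr (2 * s))
      in if a summable_on UNIV then ennreal (sqrt (\<Sum>\<^sub>\<infinity>n\<in>UNIV. a n)) else \<infinity>)"

end

theory Submission
  imports Defs "HOL-Real_Asymp.Real_Asymp"
begin

text \<open>
  The estimate is one for harmonic conjugation: it holds for the boundary values of every
  \<open>F = u + \<i> v\<close> that is holomorphic in \<open>\<Omega>\<close>, continuous on its closure and satisfies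
  \<open>v z0 = 0\<close>. Let \<open>\<Theta> w = \<Psi> (\<rho> w)\<close> and let \<open>a n\<close> be the Fourier coefficients of \<open>F \<circ> \<Theta>\<close> on the unit circle.
  Since \<open>F \<circ> \<Theta>\<close> is holomorphic in a collar inside the circle, \<open>|a (- n)| \<le> M q ^ n\<close> for \<open>n \<ge> 0\<close>, where \<open>M\<close> is
  the maximum of \<open>|F \<circ> \<Theta>|\<close> on \<open>|w| = q < 1\<close>. As \<open>u\<close> and \<open>v\<close> have the coefficients
  \<open>(a n \<plusminus> cnj (a (- n))) / 2\<close> (up to the factor \<open>1 / \<i>\<close>), those of \<open>v\<close> are dominated by those of \<open>u\<close> plus
  \<open>M q ^ |n|\<close>, and it remains to bound \<open>M\<close> by the Sobolev norm of \<open>u\<close>.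

  If there were no such bound, there would be a sequence with \<open>M = 1\<close> and \<open>u\<close> tending to zero. Its Laurent
  series are locally bounded near the boundary, so by the maximum principle and Montel's theorem
  a subsequence converges to some \<open>G\<close> with \<open>a n + cnj (a (- n)) = 0\<close>. Then \<open>Re G\<close> tends to zero at the
  boundary, hence \<open>G\<close> is constant, hence zero, which contradicts \<open>M = 1\<close>.
\<close>

section \<open>Laurent series on an annulus\<close>

definition annulus :: "real \<Rightarrow> real \<Rightarrow> complex set" where
  "annulus p r = {w. p < cmod w \<and> cmod w < r}"

text \<open>For \<open>t > 0\<close> this is the contour integral of \<open>\<phi> w / w\<close>
  over the circle of radius \<open>t\<close>, divided by \<open>2 * pi * \<i>\<close>. The angle
  runs over the unit interval, as in \<open>fourier_coeff\<close>.\<close>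

definition circ_mean :: "(complex \<Rightarrow> complex) \<Rightarrow> real \<Rightarrow> complex" where
  "circ_mean \<phi> t = integral {0..1} (\<lambda>\<tau>. \<phi> (of_real t * cis (2 * pi * \<tau>)))"

text \<open>For \<open>\<phi>\<close> holomorphic near the circle this is the Laurent coefficient of
  index \<open>n\<close> times \<open>t powi n\<close>. As a Fourier coefficient it also makes sense
  on the unit circle, where \<open>\<phi>\<close> has only continuous boundary values.\<close>

definition circ_coeff :: "(complex \<Rightarrow> complex) \<Rightarrow> real \<Rightarrow> int \<Rightarrow> complex" where
  "circ_coeff \<phi> t n =
     integral {0..1} (\<lambda>\<tau>. \<phi> (of_real t * cis (2 * pi * \<tau>)) * cis (- 2 * pi * of_int n * \<tau>))"

lemma open_annulus: "open (annulus p r)"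
  unfolding annulus_def by (intro open_Collect_conj open_Collect_less continuous_intros)

lemma continuous_on_circ:
  assumes "continuous_on (sphere 0 t) \<phi>" "0 \<le> t"
  shows "continuous_on S (\<lambda>\<tau>. \<phi> (of_real t * cis (2 * pi * \<tau>)))"
  by (rule continuous_on_compose2[OF assms(1)])
    (use assms(2) in \<open>auto intro!: continuous_intros simp: norm_mult\<close>)

text \<open>Both means are contour integrals of \<open>\<phi> w / w\<close> up to a common factor,
  and the two circles are homotopic within the annulus.\<close>

lemma circ_mean_eq:
  assumes hol: "\<phi> holomorphic_on annulus p r" and "0 \<le> p" "p < t1" "t1 < r" "p < t2" "t2 < r"
  shows "circ_mean \<phi> t1 = circ_mean \<phi> t2"
proof -
  have 0: "0 \<notin> annulus p r" using assms by (auto simp: annulus_def)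
  have hol': "(\<lambda>w. \<phi> w / w) holomorphic_on annulus p r"
    using 0 by (intro holomorphic_intros hol) auto
  have *: "contour_integral (circlepath 0 t) (\<lambda>w. \<phi> w / w) = 2 * pi * \<i> * circ_mean \<phi> t"
    if "p < t" for t
  proof -
    have "contour_integral (circlepath 0 t) (\<lambda>w. \<phi> w / w) =
        integral {0..1} (\<lambda>x. 2 * pi * \<i> * \<phi> (of_real t * cis (2 * pi * x)))"
      unfolding contour_integral_integral vector_derivative_circlepath
      using that assms
      by (intro integral_cong) (simp add: circlepath cis_conv_exp mult_ac field_simps)
    then show ?thesis by (simp add: circ_mean_def)
  qed
  \<comment> \<open>The linear homotopy moves each point along its own ray, so the modulus stays
    between \<open>t1\<close> and \<open>t2\<close>.\<close>
  have seg: "closed_segment (circlepath 0 t1 x) (circlepath 0 t2 x) \<subseteq> annulus p r" for x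
  proof
    fix y assume "y \<in> closed_segment (circlepath 0 t1 x) (circlepath 0 t2 x)"
    then obtain u where u: "0 \<le> u" "u \<le> 1"
      and y: "y = (1 - u) *\<^sub>R circlepath 0 t1 x + u *\<^sub>R circlepath 0 t2 x"
      unfolding in_segment by blast
    have "y = of_real ((1 - u) * t1 + u * t2) * cis (2 * pi * x)"
      unfolding y by (simp add: circlepath cis_conv_exp scaleR_conv_of_real algebra_simps)
    moreover have "(1 - u) * t1 + u * t2 \<in> {p<..<r}"
      using assms u convexD[of "{p<..<r}" t1 t2 "1-u" u] by auto
    moreover from this have "cmod (of_real ((1 - u) * t1 + u * t2)) = (1 - u) * t1 + u * t2"
      using assms(2) by (subst norm_of_real) auto
    ultimately show "y \<in> annulus p r" by (simp add: annulus_def norm_mult del: of_real_add of_real_mult)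
  qed
  have "contour_integral (circlepath 0 t1) (\<lambda>w. \<phi> w / w) =
        contour_integral (circlepath 0 t2) (\<lambda>w. \<phi> w / w)"
    by (rule Cauchy_theorem_homotopic_loops[OF _ open_annulus hol'])
      (auto intro!: homotopic_loops_linear intro: seg[THEN subsetD])
  then show ?thesis using * assms by simp
qed

lemma circ_coeff_eq_mean:
  assumes "0 < t"
  shows "circ_coeff \<phi> t n = circ_mean (\<lambda>w. \<phi> w * w powi (- n)) t * of_real t powi n"
proof -
  have "cis (- 2 * pi * of_int n * x) = (of_real t * cis (2 * pi * x)) powi (- n) * of_real t powi n" for x
    using assms by (simp add: power_int_mult_distrib cis_power_int power_int_minus mult_ac)
  then have "circ_coeff \<phi> t n =
     integral {0..1} (\<lambda>x. \<phi> (of_real t * cis (2 * pi * x)) * (of_real t * cis (2 * pi * x)) powi (- n) * of_real t powi n)"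
    unfolding circ_coeff_def by (simp add: mult_ac)
  then show ?thesis by (simp add: circ_mean_def)
qed

text \<open>After division by \<open>t powi n\<close> the coefficient is the mean of the holomorphic
  function \<open>\<phi> w * w powi (- n)\<close>, which does not depend on the radius.\<close>

lemma circ_coeff_scale:
  assumes hol: "\<phi> holomorphic_on annulus p r" and "0 \<le> p" "p < t1" "t1 < r" "p < t2" "t2 < r"
  shows "circ_coeff \<phi> t1 n = circ_coeff \<phi> t2 n * of_real (t1 / t2) powi n"
proof -
  have 0: "0 \<notin> annulus p r" using assms by (auto simp: annulus_def)
  have "(\<lambda>w. \<phi> w * w powi (- n)) holomorphic_on annulus p r"
    using 0 by (intro holomorphic_intros hol) auto
  then have "circ_mean (\<lambda>w. \<phi> w * w powi (- n)) t1 = circ_mean (\<lambda>w. \<phi> w * w powi (- n)) t2"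
    using assms by (intro circ_mean_eq)
  then show ?thesis using assms
    by (simp add: circ_coeff_eq_mean power_int_divide_distrib)
qed

section \<open>Cauchy integrals and the Laurent expansion\<close>

lemma norm_integral_unit_le:
  fixes f :: "real \<Rightarrow> complex"
  assumes "continuous_on {0..1} f" "\<And>x. x \<in> {0..1} \<Longrightarrow> cmod (f x) \<le> M"
  shows "cmod (integral {0..1} f) \<le> M"
  using integral_bound[of 0 1 f M] assms by auto

lemma norm_circ_coeff_le:
  assumes "continuous_on (sphere 0 t) \<phi>" "0 \<le> t" "\<And>w. cmod w = t \<Longrightarrow> cmod (\<phi> w) \<le> M"
  shows "cmod (circ_coeff \<phi> t n) \<le> M"
  unfolding circ_coeff_def
  by (rule norm_integral_unit_le)
    (use assms in \<open>auto intro!: continuous_intros continuous_on_circ simp: norm_mult\<close>)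

text \<open>The \<open>m\<close>-th partial sum misses the closed form by the integral of
  \<open>f s / (1 - x s) * x s ^ m\<close>, which is at most \<open>C * q ^ m\<close> because
  \<open>1 - x s\<close> stays away from zero.\<close>

lemma integral_geometric_sums:
  fixes f x :: "real \<Rightarrow> complex"
  assumes f: "continuous_on {0..1} f" and x: "continuous_on {0..1} x"
    and q: "\<And>s. s \<in> {0..1} \<Longrightarrow> cmod (x s) \<le> q" "q < 1"
  shows "(\<lambda>n. integral {0..1} (\<lambda>s. f s * x s ^ n)) sums integral {0..1} (\<lambda>s. f s / (1 - x s))"
proof -
  have ne: "x s \<noteq> 1" if "s \<in> {0..1}" for s using q(1)[OF that] q(2) by auto
  have "0 \<le> q" using order_trans[OF norm_ge_zero q(1)[of 0]] by simp
  obtain C where C: "\<And>s. s \<in> {0..1} \<Longrightarrow> cmod (f s / (1 - x s)) \<le> C"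
  proof -
    have "compact ((\<lambda>s. f s / (1 - x s)) ` {0..1})"
      using ne by (intro compact_continuous_image continuous_intros f x) auto
    then have "bounded ((\<lambda>s. f s / (1 - x s)) ` {0..1})" by (rule compact_imp_bounded)
    then show ?thesis using that unfolding bounded_iff by blast
  qed
  have eq: "(\<Sum>n<m. integral {0..1} (\<lambda>s. f s * x s ^ n)) =
     integral {0..1} (\<lambda>s. f s / (1 - x s)) - integral {0..1} (\<lambda>s. f s / (1 - x s) * x s ^ m)" for m
  proof -
    have i1: "(\<lambda>s. f s / (1 - x s) * x s ^ m) integrable_on {0..1}" for m
      using ne by (intro integrable_continuous_interval continuous_intros f x) auto
    have i2: "(\<lambda>s. f s / (1 - x s)) integrable_on {0..1}" using i1[of 0] by simp
    have i3: "(\<lambda>s. f s * x s ^ n) integrable_on {0..1}" for n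
      by (intro integrable_continuous_interval continuous_intros f x)
    have "(\<Sum>n<m. integral {0..1} (\<lambda>s. f s * x s ^ n)) = integral {0..1} (\<lambda>s. \<Sum>n<m. f s * x s ^ n)"
      using i3 by (subst integral_sum) auto
    also have "\<dots> = integral {0..1} (\<lambda>s. f s / (1 - x s) - f s / (1 - x s) * x s ^ m)"
    proof (rule integral_cong)
      fix s :: real assume s: "s \<in> {0..1}"
      have "(\<Sum>n<m. x s ^ n) = (1 - x s ^ m) / (1 - x s)"
        using ne[OF s] by (simp add: sum_gp_strict)
      then show "(\<Sum>n<m. f s * x s ^ n) = f s / (1 - x s) - f s / (1 - x s) * x s ^ m"
        by (simp add: sum_distrib_left[symmetric] right_diff_distrib diff_divide_distrib)
    qed
    also have "\<dots> = integral {0..1} (\<lambda>s. f s / (1 - x s)) - integral {0..1} (\<lambda>s. f s / (1 - x s) * x s ^ m)"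
      by (rule integral_diff[OF i2 i1])
    finally show ?thesis .
  qed
  have "(\<lambda>m. integral {0..1} (\<lambda>s. f s / (1 - x s) * x s ^ m)) \<longlonglongrightarrow> 0"
  proof (rule Lim_null_comparison)
    show "\<forall>\<^sub>F m in sequentially. norm (integral {0..1} (\<lambda>s. f s / (1 - x s) * x s ^ m)) \<le> C * q ^ m"
    proof (intro always_eventually allI norm_integral_unit_le)
      fix m
      show "continuous_on {0..1} (\<lambda>s. f s / (1 - x s) * x s ^ m)"
        using ne by (intro continuous_intros f x) auto
      fix s :: real assume s: "s \<in> {0..1}"
      show "cmod (f s / (1 - x s) * x s ^ m) \<le> C * q ^ m"
        unfolding norm_mult norm_power
        by (intro mult_mono C s power_mono q(1)) (auto intro: order_trans[OF norm_ge_zero C[OF s]])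
    qed
    show "(\<lambda>m. C * q ^ m) \<longlonglongrightarrow> 0"
      using q \<open>0 \<le> q\<close> by (auto intro!: tendsto_eq_intros LIMSEQ_realpow_zero)
  qed
  from tendsto_diff[OF tendsto_const this, of "integral {0..1} (\<lambda>s. f s / (1 - x s))"]
  show ?thesis unfolding sums_def eq by simp
qed

text \<open>On the circle the kernel \<open>\<zeta> / (\<zeta> - w)\<close> is
  \<open>1 / (1 - w / \<zeta>)\<close>, a geometric series with ratio of modulus
  \<open>cmod w / t < 1\<close>.\<close>

lemma outer_Cauchy_sums:
  assumes "continuous_on (sphere 0 t) \<phi>" "cmod w < t"
  shows "(\<lambda>n. circ_coeff \<phi> t (int n) * (w / of_real t) ^ n) sums circ_mean (\<lambda>\<zeta>. \<phi> \<zeta> * \<zeta> / (\<zeta> - w)) t"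
proof -
  have t: "t > 0" using assms(2) norm_ge_zero[of w] by linarith
  define e where "e = (\<lambda>s. cis (2 * pi * s))"
  define x where "x s = w / (of_real t * e s)" for s
  have [simp]: "cmod (e s) = 1" "e s \<noteq> 0" for s by (auto simp: e_def)
  have "(\<lambda>n. integral {0..1} (\<lambda>s. \<phi> (of_real t * e s) * x s ^ n)) sums
        integral {0..1} (\<lambda>s. \<phi> (of_real t * e s) / (1 - x s))"
  proof (rule integral_geometric_sums[where q = "cmod w / t"])
    show "continuous_on {0..1} (\<lambda>s. \<phi> (of_real t * e s))"
      unfolding e_def using assms t by (intro continuous_on_circ) auto
    show "continuous_on {0..1} x" unfolding x_def using t
      by (intro continuous_intros) (auto simp: e_def intro!: continuous_intros)
  qed (use assms t in \<open>auto simp: x_def norm_divide norm_mult\<close>)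
  moreover have "x s ^ n = cis (- 2 * pi * of_int (int n) * s) * (w / of_real t) ^ n" for s n
  proof -
    have "x s = cis (- (2 * pi * s)) * (w / of_real t)"
      by (simp add: x_def e_def cis_mult divide_inverse inverse_mult_distrib mult_ac)
    then show ?thesis
      by (simp add: power_mult_distrib power_divide Complex.DeMoivre mult_ac)
  qed
  then have "integral {0..1} (\<lambda>s. \<phi> (of_real t * e s) * x s ^ n) =
      circ_coeff \<phi> t (int n) * (w / of_real t) ^ n" for n
    by (simp add: circ_coeff_def e_def flip: mult.assoc)
  moreover have "1 / (1 - x s) = (of_real t * e s) / (of_real t * e s - w)" for s
    using t by (simp add: x_def diff_divide_eq_iff)
  then have "\<phi> (of_real t * e s) / (1 - x s) = \<phi> (of_real t * e s) * (of_real t * e s) / (of_real t * e s - w)" for s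
    by (metis mult.right_neutral times_divide_eq_right)
  ultimately show ?thesis unfolding circ_mean_def by (simp add: e_def)
qed

text \<open>Here \<open>w\<close> lies outside the circle, and
  \<open>- \<zeta> / (\<zeta> - w)\<close> is \<open>x / (1 - x)\<close> with
  \<open>x = \<zeta> / w\<close>. The series starts with the first power of \<open>x\<close>, so
  index 0 belongs to the outer expansion alone.\<close>

lemma inner_Cauchy_sums:
  assumes "continuous_on (sphere 0 t) \<phi>" "0 < t" "t < cmod w"
  shows "(\<lambda>n. circ_coeff \<phi> t (- int (Suc n)) * (of_real t / w) ^ Suc n) sums
     (- circ_mean (\<lambda>\<zeta>. \<phi> \<zeta> * \<zeta> / (\<zeta> - w)) t)"
proof -
  have w: "w \<noteq> 0" using assms by auto
  define e where "e = (\<lambda>s. cis (2 * pi * s))"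
  define x where "x s = (of_real t * e s) / w" for s
  have [simp]: "cmod (e s) = 1" "e s \<noteq> 0" for s by (auto simp: e_def)
  have cx: "continuous_on {0..1} x" unfolding x_def using w
      by (intro continuous_intros) (auto simp: e_def intro!: continuous_intros)
  have ce: "continuous_on {0..1} (\<lambda>s. \<phi> (of_real t * e s))"
      unfolding e_def using assms by (intro continuous_on_circ) auto
  have "(\<lambda>n. integral {0..1} (\<lambda>s. (\<phi> (of_real t * e s) * x s) * x s ^ n)) sums
        integral {0..1} (\<lambda>s. (\<phi> (of_real t * e s) * x s) / (1 - x s))"
  proof (rule integral_geometric_sums[where q = "t / cmod w"])
    show "continuous_on {0..1} (\<lambda>s. \<phi> (of_real t * e s) * x s)"
      by (intro continuous_intros ce cx)
    show "t / cmod w < 1" using assms by (simp add: divide_less_eq)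
  qed (use assms cx in \<open>auto simp: x_def norm_divide norm_mult\<close>)
  moreover have "x s ^ Suc n = cis (- 2 * pi * of_int (- int (Suc n)) * s) * (of_real t / w) ^ Suc n" for s n
  proof -
    have "real (Suc n) * (2 * pi * s) = - 2 * pi * of_int (- int (Suc n)) * s"
      by (simp only: of_int_minus of_int_of_nat_eq mult_minus_left mult_minus_right minus_minus mult_ac)
    then have "e s ^ Suc n = cis (- 2 * pi * of_int (- int (Suc n)) * s)"
      unfolding e_def Complex.DeMoivre by (rule arg_cong[where f = cis])
    moreover have "x s ^ Suc n = e s ^ Suc n * (of_real t / w) ^ Suc n"
      by (simp add: x_def power_mult_distrib power_divide)
    ultimately show ?thesis by (simp only:)
  qed
  then have "integral {0..1} (\<lambda>s. (\<phi> (of_real t * e s) * x s) * x s ^ n) =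
      circ_coeff \<phi> t (- int (Suc n)) * (of_real t / w) ^ Suc n" for n
    unfolding mult.assoc power_Suc[symmetric] 
    by (simp only: circ_coeff_def e_def mult.assoc[symmetric] integral_mult_left)
  moreover have "x s / (1 - x s) = - ((of_real t * e s) / (of_real t * e s - w))" for s
  proof -
    have "of_real t * e s \<noteq> w" using assms by (auto simp: norm_mult)
    then show ?thesis using w by (simp add: x_def divide_simps) (simp add: algebra_simps)
  qed
  then have "\<phi> (of_real t * e s) * x s / (1 - x s) =
     - (\<phi> (of_real t * e s) * (of_real t * e s) / (of_real t * e s - w))" for s
    by (metis mult_minus_right times_divide_eq_right)
  ultimately show ?thesis unfolding circ_mean_def by (simp add: e_def)
qed

text \<open>The difference quotient \<open>k\<close> has a removable singularity at
  \<open>w\<close>, so \<open>k \<zeta> * \<zeta>\<close> has equal means on both circles. Splitting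
  the quotient leaves the means of \<open>\<zeta> / (\<zeta> - w)\<close>, which are 1 on the outer
  and 0 on the inner circle.\<close>

lemma Cauchy_annulus:
  assumes hol: "\<phi> holomorphic_on annulus p r" and "0 \<le> p" "p < t1" "t1 < cmod w" "cmod w < t2" "t2 < r"
  shows "\<phi> w = circ_mean (\<lambda>\<zeta>. \<phi> \<zeta> * \<zeta> / (\<zeta> - w)) t2 - circ_mean (\<lambda>\<zeta>. \<phi> \<zeta> * \<zeta> / (\<zeta> - w)) t1"
proof -
  let ?A = "annulus p r"
  define k where "k \<zeta> = (if \<zeta> = w then deriv \<phi> w else (\<phi> \<zeta> - \<phi> w) / (\<zeta> - w))" for \<zeta>
  have k: "k holomorphic_on ?A" unfolding k_def
    using pole_lemma_open[OF hol open_annulus] .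
  have eq: "circ_mean (\<lambda>\<zeta>. k \<zeta> * \<zeta>) t1 = circ_mean (\<lambda>\<zeta>. k \<zeta> * \<zeta>) t2"
    using assms by (intro circ_mean_eq[of _ p r] holomorphic_intros k) auto
  have cont: "continuous_on (sphere 0 t) \<phi>" if "p < t" "t < r" for t
    by (rule continuous_on_subset[OF holomorphic_on_imp_continuous_on[OF hol]])
      (use that in \<open>auto simp: annulus_def\<close>)
  have split: "circ_mean (\<lambda>\<zeta>. k \<zeta> * \<zeta>) t = circ_mean (\<lambda>\<zeta>. \<phi> \<zeta> * \<zeta> / (\<zeta> - w)) t - \<phi> w * circ_mean (\<lambda>\<zeta>. \<zeta> / (\<zeta> - w)) t"
    if "p < t" "t < r" "t \<noteq> cmod w" for t
  proof -
    define e where "e s = of_real t * cis (2 * pi * s)" for s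
    have ne: "e s \<noteq> w" for s using that assms by (auto simp: e_def norm_mult)
    have c: "continuous_on {0..1} e" unfolding e_def by (intro continuous_intros)
    have ce: "continuous_on {0..1} (\<lambda>s. \<phi> (e s))"
      unfolding e_def using that assms cont by (intro continuous_on_circ) auto
    have "circ_mean (\<lambda>\<zeta>. k \<zeta> * \<zeta>) t =
       integral {0..1} (\<lambda>s. \<phi> (e s) * e s / (e s - w) - \<phi> w * (e s / (e s - w)))"
      unfolding circ_mean_def using ne
      by (intro integral_cong) (simp add: k_def e_def diff_divide_distrib algebra_simps)
    also have "\<dots> = integral {0..1} (\<lambda>s. \<phi> (e s) * e s / (e s - w)) - integral {0..1} (\<lambda>s. \<phi> w * (e s / (e s - w)))"
      using ne by (intro integral_diff integrable_continuous_interval continuous_intros c ce) auto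
    finally show ?thesis
      unfolding circ_mean_def e_def integral_mult_right .
  qed
  \<comment> \<open>Inserting the coefficients of the constant 1 into the two geometric expansions
    evaluates the means of \<open>\<zeta> / (\<zeta> - w)\<close>.\<close>
  have cc: "circ_coeff (\<lambda>_. 1) t n = (if n = 0 then 1 else 0)" if "0 < t" for t n
  proof (cases "n = 0")
    case False
    define c where "c = - 2 * pi * of_int n"
    have "c \<noteq> 0" using False by (simp add: c_def)
    have "((\<lambda>z. exp (k * z) / k) has_field_derivative exp (k * z)) (at z)" if "k \<noteq> 0" for k z :: complex
      using that by (auto intro!: derivative_eq_intros)
    from this[of "\<i> * of_real c"] \<open>c \<noteq> 0\<close>
    have "((\<lambda>z. exp (\<i> * of_real c * z) / (\<i> * of_real c)) has_field_derivative exp (\<i> * of_real c * z)) (at z)" for z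
      by simp
    from has_vector_derivative_real_field[OF this]
    have "((\<lambda>x. cis (c * x) / (\<i> * of_real c)) has_vector_derivative cis (c * x)) (at x within {0..1})" for x
      by (simp add: cis_conv_exp mult.assoc)
    then have "((\<lambda>x. cis (c * x)) has_integral (cis (c * 1) / (\<i> * of_real c) - cis (c * 0) / (\<i> * of_real c))) {0..1}"
      by (intro fundamental_theorem_of_calculus) auto
    moreover have "cis (c * 1) = 1"
      using cis_multiple_2pi[of "- of_int n"] by (simp add: c_def mult_ac)
    ultimately have "((\<lambda>x. cis (- 2 * pi * of_int n * x)) has_integral 0) {0..1::real}" by (simp add: c_def)
    then show ?thesis using False by (simp add: circ_coeff_def integral_unique)
  qed (simp add: circ_coeff_def)
  have m2: "circ_mean (\<lambda>\<zeta>. \<zeta> / (\<zeta> - w)) t2 = 1"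
  proof -
    have "(\<lambda>n. circ_coeff (\<lambda>_. 1) t2 (int n) * (w / of_real t2) ^ n) = (\<lambda>n. if n = 0 then 1 else 0)"
      using assms by (auto simp: cc)
    then have "(\<lambda>n. if n = 0 then 1 else 0) sums circ_mean (\<lambda>\<zeta>. \<zeta> / (\<zeta> - w)) t2"
      using outer_Cauchy_sums[of t2 "\<lambda>_. 1" w] assms by simp
    from sums_unique2[OF this sums_single[of 0 "\<lambda>_. 1::complex"]] show ?thesis .
  qed
  have m1: "circ_mean (\<lambda>\<zeta>. \<zeta> / (\<zeta> - w)) t1 = 0"
  proof -
    have "(\<lambda>n. 0) sums (- circ_mean (\<lambda>\<zeta>. \<zeta> / (\<zeta> - w)) t1)"
      using inner_Cauchy_sums[of t1 "\<lambda>_. 1" w] assms by (simp add: cc del: of_nat_Suc)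
    from sums_unique2[OF this sums_zero] show ?thesis by simp
  qed
  have "p < t2" "t1 < r" "t1 \<noteq> cmod w" "t2 \<noteq> cmod w" using assms by auto
  then show ?thesis using eq
    unfolding split[OF \<open>p < t1\<close> \<open>t1 < r\<close> \<open>t1 \<noteq> cmod w\<close>] split[OF \<open>p < t2\<close> \<open>t2 < r\<close> \<open>t2 \<noteq> cmod w\<close>] m1 m2
    by (simp add: algebra_simps)
qed

text \<open>Cauchy's formula is expanded on auxiliary circles on either side of \<open>w\<close>;
  \<open>circ_coeff_scale\<close> then expresses all coefficients at the single radius
  \<open>t\<close>, which may lie on either side of \<open>cmod w\<close>.\<close>

lemma Laurent_annulus:
  assumes hol: "\<phi> holomorphic_on annulus p r" and "0 \<le> p" "p < t" "t < r" "w \<in> annulus p r"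
  obtains A B where
    "(\<lambda>n. circ_coeff \<phi> t (int n) * (w / of_real t) ^ n) sums A"
    "(\<lambda>n. circ_coeff \<phi> t (- int (Suc n)) * (of_real t / w) ^ Suc n) sums B"
    "\<phi> w = A + B"
proof -
  have w: "p < cmod w" "cmod w < r" using assms by (auto simp: annulus_def)
  obtain t1 where t1: "p < t1" "t1 < cmod w" using dense w by blast
  obtain t2 where t2: "cmod w < t2" "t2 < r" using dense w by blast
  have cont: "continuous_on (sphere 0 t) \<phi>" if "p < t" "t < r" for t
    by (rule continuous_on_subset[OF holomorphic_on_imp_continuous_on[OF hol]])
      (use that in \<open>auto simp: annulus_def\<close>)
  have w0: "w \<noteq> 0" "t \<noteq> 0" "t1 > 0" "t2 > 0" using assms w t1 t2 by auto
  have "circ_coeff \<phi> t2 (int n) * (w / of_real t2) ^ n = circ_coeff \<phi> t (int n) * (w / of_real t) ^ n" for n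
    using circ_coeff_scale[OF hol, of t2 t "int n"] assms t1 t2 w w0
    by (simp add: field_simps power_int_of_nat)
  moreover have "circ_coeff \<phi> t1 (- int (Suc n)) * (of_real t1 / w) ^ Suc n =
      circ_coeff \<phi> t (- int (Suc n)) * (of_real t / w) ^ Suc n" for n
  proof -
    have "circ_coeff \<phi> t1 (- int (Suc n)) = circ_coeff \<phi> t (- int (Suc n)) * inverse (of_real (t1 / t) ^ Suc n)"
      using circ_coeff_scale[OF hol, of t1 t "- int (Suc n)"] assms t1 t2 w w0
      by (simp only: power_int_minus power_int_of_nat)
    then show ?thesis using w0 by (simp add: field_simps)
  qed
  moreover have "continuous_on (sphere 0 t1) \<phi>" "continuous_on (sphere 0 t2) \<phi>"
    using t1 t2 w by (intro cont; linarith)+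
  note outer_Cauchy_sums[OF this(2) t2(1)] inner_Cauchy_sums[OF this(1) w0(3) t1(2)]
  ultimately show ?thesis
    using that[OF _ _ Cauchy_annulus[OF hol assms(2) t1 t2, THEN trans[OF _ diff_conv_add_uminus]]]
    by (simp only:)
qed

text \<open>Scaling from radius \<open>u\<close> to \<open>t\<close> is exact for
  \<open>u < 1\<close>, and the coefficient is continuous in \<open>u\<close> up to 1; the identity
  follows by letting \<open>u\<close> tend to 1 from the left.\<close>

lemma circ_coeff_limit:
  assumes cont: "continuous_on {w. p < cmod w \<and> cmod w \<le> 1} \<phi>"
    and hol: "\<phi> holomorphic_on annulus p 1" and "0 \<le> p" "p < t" "t < 1"
  shows "circ_coeff \<phi> t n = circ_coeff \<phi> 1 n * of_real t powi n"
proof -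
  have "continuous_on {t..1} (\<lambda>u. circ_coeff \<phi> u n)"
  proof -
    have "continuous_on ({t..1} \<times> cbox 0 1)
      (\<lambda>(u, \<tau>). \<phi> (of_real u * cis (2 * pi * \<tau>)) * cis (- 2 * pi * of_int n * \<tau>))"
      unfolding split_beta
      by (intro continuous_intros continuous_on_compose2[OF cont])
        (use assms in \<open>auto simp: norm_mult\<close>)
    from integral_continuous_on_param[OF this] show ?thesis by (simp add: circ_coeff_def)
  qed
  then have c: "continuous_on {t..1} (\<lambda>u. circ_coeff \<phi> u n * of_real (t / u) powi n)"
    using assms by (intro continuous_intros) auto
  have "circ_coeff \<phi> u n * of_real (t / u) powi n = circ_coeff \<phi> t n" if "t \<le> u" "u < 1" for u
    using circ_coeff_scale[OF hol, of t u n] that assms by auto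
  then have "((\<lambda>u. circ_coeff \<phi> u n * of_real (t / u) powi n) \<longlongrightarrow> circ_coeff \<phi> t n) (at_left 1)"
    using assms by (intro tendsto_eventually) (auto simp: eventually_at_left[of t] intro!: exI[of _ t])
  moreover have "((\<lambda>u. circ_coeff \<phi> u n * of_real (t / u) powi n) \<longlongrightarrow> circ_coeff \<phi> 1 n * of_real (t / 1) powi n) (at_left 1)"
    using c[unfolded continuous_on_def, rule_format, of 1] assms
    unfolding at_within_Icc_at_left[OF \<open>t < 1\<close>] by simp
  ultimately show ?thesis using tendsto_unique[OF trivial_limit_at_left_real] by fastforce
qed

section \<open>Coefficients of real and imaginary parts, and of uniform limits\<close>

lemma circ_coeff_add:
  assumes "continuous_on (sphere 0 t) \<phi>" "continuous_on (sphere 0 t) \<psi>" "0 \<le> t"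
  shows "circ_coeff (\<lambda>w. \<phi> w + \<psi> w) t n = circ_coeff \<phi> t n + circ_coeff \<psi> t n"
  unfolding circ_coeff_def ring_distribs
  using assms
  by (intro integral_add integrable_continuous_interval continuous_intros continuous_on_circ)

lemma circ_coeff_cmult: "circ_coeff (\<lambda>w. c * \<phi> w) t n = c * circ_coeff \<phi> t n"
  unfolding circ_coeff_def mult.assoc by (rule integral_mult_right)

lemma circ_coeff_cnj: "circ_coeff (\<lambda>w. cnj (\<phi> w)) t n = cnj (circ_coeff \<phi> t (- n))"
  unfolding circ_coeff_def integral_cnj by (simp add: cis_cnj)

lemma circ_coeff_Re:
  assumes "continuous_on (sphere 0 t) \<phi>" "0 \<le> t"
  shows "circ_coeff (\<lambda>w. of_real (Re (\<phi> w))) t n = (circ_coeff \<phi> t n + cnj (circ_coeff \<phi> t (- n))) / 2"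
proof -
  have "2 * circ_coeff (\<lambda>w. of_real (Re (\<phi> w))) t n = circ_coeff (\<lambda>w. \<phi> w + cnj (\<phi> w)) t n"
    by (simp add: complex_add_cnj circ_coeff_cmult)
  also have "\<dots> = circ_coeff \<phi> t n + cnj (circ_coeff \<phi> t (- n))"
    using assms by (subst circ_coeff_add) (auto intro!: continuous_intros simp: circ_coeff_cnj)
  finally show ?thesis by (simp add: mult.commute)
qed

lemma circ_coeff_Im:
  assumes "continuous_on (sphere 0 t) \<phi>" "0 \<le> t"
  shows "circ_coeff (\<lambda>w. of_real (Im (\<phi> w))) t n = (circ_coeff \<phi> t n - cnj (circ_coeff \<phi> t (- n))) / (2 * \<i>)"
proof -
  \<comment> \<open>The imaginary part of \<open>\<phi>\<close> is the real part of
    \<open>- \<i> * \<phi>\<close>.\<close>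
  have "circ_coeff (\<lambda>w. of_real (Re (- \<i> * \<phi> w))) t n = (- \<i> * circ_coeff \<phi> t n + cnj (- \<i> * circ_coeff \<phi> t (- n))) / 2"
    using assms by (subst circ_coeff_Re[where \<phi> = "\<lambda>w. - \<i> * \<phi> w"])
      (auto intro!: continuous_intros simp only: circ_coeff_cmult)
  also have "\<dots> = (circ_coeff \<phi> t n - cnj (circ_coeff \<phi> t (- n))) / (2 * \<i>)"
    by (simp add: divide_simps) (simp add: algebra_simps)
  finally show ?thesis by simp
qed

text \<open>A coefficient is bounded by the maximum modulus on the circle; this is applied to the
  difference \<open>f k - g\<close>.\<close>

lemma circ_coeff_uniform_limit:
  assumes lim: "uniform_limit (sphere 0 t) f g sequentially" and "0 \<le> t"
    and cont: "\<And>k. continuous_on (sphere 0 t) (f k)"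
  shows "(\<lambda>k. circ_coeff (f k) t n) \<longlonglongrightarrow> circ_coeff g t n"
proof -
  have contg: "continuous_on (sphere 0 t) g"
    using uniform_limit_theorem[OF _ lim] cont by auto
  have "(\<lambda>k. circ_coeff (f k) t n - circ_coeff g t n) \<longlonglongrightarrow> 0"
  proof (rule tendstoI)
    fix e :: real assume "e > 0"
    then have "e / 2 > 0" by simp
    with lim have "\<forall>\<^sub>F k in sequentially. \<forall>w\<in>sphere 0 t. dist (f k w) (g w) < e / 2"
      unfolding uniform_limit_iff by blast
    then show "\<forall>\<^sub>F k in sequentially. dist (circ_coeff (f k) t n - circ_coeff g t n) 0 < e"
    proof (rule eventually_mono)
      fix k assume k: "\<forall>w\<in>sphere 0 t. dist (f k w) (g w) < e / 2"
      have "circ_coeff (\<lambda>w. f k w + (- 1) * g w) t n = circ_coeff (f k) t n - circ_coeff g t n"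
        using assms contg
        by (subst circ_coeff_add) (auto intro!: continuous_intros simp: circ_coeff_cmult[of "-1", simplified])
      moreover have "cmod (circ_coeff (\<lambda>w. f k w + (- 1) * g w) t n) \<le> e / 2"
        using k assms contg
        by (intro norm_circ_coeff_le continuous_intros) (auto simp: dist_norm less_imp_le)
      ultimately show "dist (circ_coeff (f k) t n - circ_coeff g t n) 0 < e"
        using \<open>e > 0\<close> by simp
    qed
  qed
  then show ?thesis by (simp add: LIM_zero_iff)
qed

section \<open>Pointwise bounds from coefficients and back\<close>

lemma norm_circ_coeff_neg_le:
  assumes cont: "continuous_on {w. p < cmod w \<and> cmod w \<le> 1} \<phi>"
    and hol: "\<phi> holomorphic_on annulus p 1" and "0 \<le> p" "p < q" "q < 1"
    and M: "\<And>w. cmod w = q \<Longrightarrow> cmod (\<phi> w) \<le> M"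
  shows "cmod (circ_coeff \<phi> 1 (- int n)) \<le> M * q ^ n"
proof -
  \<comment> \<open>Holomorphy down to radius \<open>q\<close> yields the decay: moving index
    \<open>- n\<close> from radius \<open>q\<close> to 1 costs a factor
    \<open>q ^ n\<close>.\<close>
  have "cmod (circ_coeff \<phi> 1 (- int n)) = cmod (circ_coeff \<phi> q (- int n)) * q ^ n"
    using circ_coeff_limit[OF cont hol, of q "- int n"] assms(3-5)
    by (simp add: norm_mult norm_power_int power_int_minus norm_inverse norm_power)
  moreover have "cmod (circ_coeff \<phi> q (- int n)) \<le> M"
    using assms by (intro norm_circ_coeff_le continuous_on_subset[OF cont]) auto
  ultimately show ?thesis using assms by (auto intro: mult_right_mono)
qed

text \<open>The positive-frequency coefficients are controlled by those of the real part, the negative ones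
  by the values on an inner circle.\<close>

lemma annulus_bound_of_Re:
  assumes cont: "continuous_on {w. p < cmod w \<and> cmod w \<le> 1} \<phi>"
    and hol: "\<phi> holomorphic_on annulus p 1" and "0 \<le> p" "p < q" "q < 1"
    and M: "\<And>w. cmod w = q \<Longrightarrow> cmod (\<phi> w) \<le> M"
    and Re: "\<And>n. cmod (circ_coeff (\<lambda>w. of_real (Re (\<phi> w))) 1 (int n)) \<le> \<omega> n"
    and summ: "summable (\<lambda>n. \<omega> n * t ^ n)" and t: "q < t" "t < 1" and w: "cmod w = t"
  shows "cmod (\<phi> w) \<le> (\<Sum>n. (2 * \<omega> n + M * q ^ n) * t ^ n) + (\<Sum>n. M * (q / t) ^ Suc n)"
proof -
  have cq: "continuous_on (sphere 0 u) \<phi>" if "p < u" "u \<le> 1" for u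
    using that by (intro continuous_on_subset[OF cont]) auto
  have q0: "q > 0" using assms by auto
  have a: "cmod (circ_coeff \<phi> 1 (int n)) \<le> 2 * \<omega> n + M * q ^ n" for n
  proof -
    have "circ_coeff \<phi> 1 (int n) = 2 * circ_coeff (\<lambda>w. of_real (Re (\<phi> w))) 1 (int n) - cnj (circ_coeff \<phi> 1 (- int n))"
      using assms by (subst circ_coeff_Re) (auto intro!: cq simp: add_divide_distrib)
    then have "cmod (circ_coeff \<phi> 1 (int n)) \<le> 2 * cmod (circ_coeff (\<lambda>w. of_real (Re (\<phi> w))) 1 (int n)) + cmod (circ_coeff \<phi> 1 (- int n))"
      by (metis (no_types, lifting) complex_mod_cnj norm_mult norm_numeral norm_triangle_ineq4)
    then show ?thesis using Re[of n] norm_circ_coeff_neg_le[OF cont hol assms(3-5) M, of n] by linarith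
  qed
  \<comment> \<open>The expansion must be based at a radius inside the annulus, so \<open>q\<close>
    is used. The part \<open>A\<close> is afterwards rewritten with boundary coefficients, while
    \<open>B\<close> is estimated directly at radius \<open>q\<close>.\<close>
  obtain A B where A: "(\<lambda>n. circ_coeff \<phi> q (int n) * (w / of_real q) ^ n) sums A"
    and B: "(\<lambda>n. circ_coeff \<phi> q (- int (Suc n)) * (of_real q / w) ^ Suc n) sums B" and AB: "\<phi> w = A + B"
    using Laurent_annulus[OF hol, of q w] assms by (auto simp: annulus_def)
  have s1: "summable (\<lambda>n. (2 * \<omega> n + M * q ^ n) * t ^ n)"
  proof -
    have "q * t < 1 * 1" using q0 t assms by (intro mult_strict_mono) auto
    then have "summable (\<lambda>n. 2 * (\<omega> n * t ^ n) + M * (q * t) ^ n)"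
      using q0 t summ by (intro summable_add summable_mult summable_geometric) auto
    then show ?thesis by (simp add: algebra_simps power_mult_distrib)
  qed
  have s2: "summable (\<lambda>n. M * (q / t) ^ Suc n)"
    using q0 t by (intro summable_mult summable_Suc_iff[THEN iffD2] summable_geometric) auto
  have "cmod (circ_coeff \<phi> q (int n) * (w / of_real q) ^ n) \<le> (2 * \<omega> n + M * q ^ n) * t ^ n" for n
    using circ_coeff_limit[OF cont hol, of q "int n"] assms(3-5) q0 a[of n] w t
    by (auto simp: norm_mult norm_power norm_divide power_divide intro!: mult_right_mono)
  then have "cmod A \<le> (\<Sum>n. (2 * \<omega> n + M * q ^ n) * t ^ n)"
    by (rule norm_sums_le[OF A summable_sums[OF s1]])
  moreover have "cmod (circ_coeff \<phi> q (- int (Suc n)) * (of_real q / w) ^ Suc n) \<le> M * (q / t) ^ Suc n" for n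
  proof -
    have "cmod (circ_coeff \<phi> q (- int (Suc n))) \<le> M"
      using assms by (intro norm_circ_coeff_le cq) auto
    then show ?thesis unfolding norm_mult norm_power norm_divide w norm_of_real
      using q0 t by (intro mult_mono) (auto intro: order_trans[OF norm_ge_zero])
  qed
  then have "cmod B \<le> (\<Sum>n. M * (q / t) ^ Suc n)"
    by (rule norm_sums_le[OF B summable_sums[OF s2]])
  ultimately show ?thesis unfolding AB using norm_triangle_ineq[of A B] by linarith
qed

text \<open>The hypothesis says that the Laurent series, formally continued to the unit circle, is
  imaginary there. In the real part the terms with indices \<open>n\<close> and \<open>- n\<close> then cancel as \<open>w\<close> approaches
  that circle.\<close>

lemma Re_bound_of_antisymmetric:
  assumes hol: "\<phi> holomorphic_on annulus p 1" and "0 \<le> p" "p < q" "q < 1"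
    and M: "\<And>w. cmod w = q \<Longrightarrow> cmod (\<phi> w) \<le> M"
    and anti: "\<And>n. circ_coeff \<phi> q (int n) = - of_real (q ^ (2 * n)) * cnj (circ_coeff \<phi> q (- int n))"
    and t: "q < t" "t < 1" and w: "cmod w = t"
  shows "\<bar>Re (\<phi> w)\<bar> \<le> M * ((q / t) / (1 - q / t) - q * t / (1 - q * t))"
proof -
  have q0: "q > 0" using assms by auto
  have qt: "q * t < 1" using mult_strict_mono[of q 1 t 1] q0 t assms by auto
  obtain A B where A: "(\<lambda>n. circ_coeff \<phi> q (int n) * (w / of_real q) ^ n) sums A"
    and B: "(\<lambda>n. circ_coeff \<phi> q (- int (Suc n)) * (of_real q / w) ^ Suc n) sums B" and AB: "\<phi> w = A + B"
    using Laurent_annulus[OF hol, of q w] assms by (auto simp: annulus_def)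
  let ?f = "\<lambda>n. circ_coeff \<phi> q (int n) * (w / of_real q) ^ n"
  \<comment> \<open>Dropping index 0 aligns the two series; the dropped term is purely imaginary by
    \<open>anti\<close> at 0.\<close>
  have "(\<lambda>n. ?f (Suc n)) sums (A - ?f 0)"
    using A by (subst sums_Suc_iff) simp
  from sums_Re[OF sums_add[OF this B]]
  have "(\<lambda>n. Re (?f (Suc n) + circ_coeff \<phi> q (- int (Suc n)) * (of_real q / w) ^ Suc n)) sums Re (A - ?f 0 + B)" .
  moreover have "Re (A - ?f 0 + B) = Re (\<phi> w)"
    using arg_cong[OF anti[of 0], of Re] by (simp add: AB)
  \<comment> \<open>By \<open>anti\<close>, the term of index \<open>n\<close> is minus the
    conjugate of its partner times \<open>t ^ (2 * n)\<close>. The real part of the pair thus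
    carries the factor \<open>1 - t ^ (2 * n)\<close>, which vanishes as \<open>t\<close> tends to
    1.\<close>
  moreover have "Re (?f n + circ_coeff \<phi> q (- int n) * (of_real q / w) ^ n) =
      Re (circ_coeff \<phi> q (- int n) * (of_real q / w) ^ n * of_real (1 - t ^ (2 * n)))" (is "?L = ?R") for n
  proof -
    let ?c = "circ_coeff \<phi> q (- int n)"
    have w0: "w \<noteq> 0" using w t q0 by auto
    define X s where "X = ?c * (of_real q / w) ^ n" and "s = t ^ (2 * n)"
    have "cnj w = t\<^sup>2 / w"
      using complex_norm_square[of w] w w0 by (simp add: field_simps)
    then have cw: "cnj ?c * (of_real q * w) ^ n = cnj (X * of_real s)"
      unfolding X_def s_def using w0 q0 t by (simp add: power_mult power_divide power_mult_distrib)
    have "?f n = - (cnj ?c * (of_real q * w) ^ n)"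
      using q0 unfolding anti[of n] by (simp add: power_divide power_mult_distrib power_mult power2_eq_square)
    then have "?f n = - cnj (X * of_real s)" by (simp only: cw)
    then show ?thesis unfolding X_def[symmetric] s_def[symmetric] by (simp add: right_diff_distrib)
  qed
  ultimately have S: "(\<lambda>n. Re (circ_coeff \<phi> q (- int (Suc n)) * (of_real q / w) ^ Suc n * of_real (1 - t ^ (2 * Suc n)))) sums Re (\<phi> w)"
    by (simp only:)
  have geo: "(\<lambda>n. x ^ Suc n) sums (x / (1 - x))" if "0 \<le> x" "x < 1" for x :: real
    using sums_mult[OF geometric_sums[of x], of x] that by simp
  have T: "(\<lambda>n. M * ((q / t) ^ Suc n - (q * t) ^ Suc n)) sums (M * ((q / t) / (1 - q / t) - q * t / (1 - q * t)))"
    using q0 t qt by (intro sums_mult sums_diff geo) auto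
  have "norm (Re (circ_coeff \<phi> q (- int n) * (of_real q / w) ^ n * of_real (1 - t ^ (2 * n)))) \<le>
        M * ((q / t) ^ n - (q * t) ^ n)" for n
  proof -
    have "cmod (circ_coeff \<phi> q (- int n)) \<le> M"
      using assms
      by (intro norm_circ_coeff_le holomorphic_on_imp_continuous_on holomorphic_on_subset[OF hol])
        (auto simp: annulus_def)
    moreover have "(q / t) ^ n * (1 - t ^ (2 * n)) = (q / t) ^ n - (q * t) ^ n"
      using q0 t by (simp add: field_simps power_mult_distrib power_mult power2_eq_square)
    moreover have "t ^ (2 * n) \<le> 1" using q0 t by (intro power_le_one) auto
    ultimately have "cmod (circ_coeff \<phi> q (- int n) * (of_real q / w) ^ n * of_real (1 - t ^ (2 * n)))
        \<le> M * ((q / t) ^ n - (q * t) ^ n)"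
      unfolding norm_mult norm_power norm_divide w norm_of_real mult.assoc
      using q0 t by (auto intro!: mult_right_mono simp flip: \<open>(q / t) ^ n * _ = _\<close>)
    then show ?thesis unfolding real_norm_def by (rule order_trans[OF abs_Re_le_cmod])
  qed
  then have "norm (Re (\<phi> w)) \<le> M * ((q / t) / (1 - q / t) - q * t / (1 - q * t))"
    by (rule norm_sums_le[OF S T])
  then show ?thesis by simp
qed

section \<open>Analytic collars of the boundary\<close>

text \<open>The peripheral map with its reference circle rescaled to the unit circle. Only the outer
  side is prescribed; that the inner side goes into \<Omega> is derived in
  \<open>inside\<close>.\<close>

locale collar =
  fixes \<Omega> :: "complex set" and \<Theta> :: "complex \<Rightarrow> complex" and p r :: real
  assumes open_region: "open \<Omega>" and connected_region: "connected \<Omega>" and bounded_region: "bounded \<Omega>"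
    and radii: "0 \<le> p" "p < 1" "1 < r"
    and hol: "\<Theta> holomorphic_on annulus p r" and inj: "inj_on \<Theta> (annulus p r)"
    and boundary: "\<Theta> ` sphere 0 1 = frontier \<Omega>"
    and outside: "\<And>w. 1 < cmod w \<Longrightarrow> cmod w < r \<Longrightarrow> \<Theta> w \<notin> closure \<Omega>"
begin

text \<open>For \<open>t\<close> increasing to 1 these sets exhaust \<Omega>, and their frontiers
  lie on the images of circles. They carry bounds from circles to compact subsets of \<Omega> by the
  maximum principle.\<close>

definition core :: "real \<Rightarrow> complex set" where
  "core t = \<Omega> - \<Theta> ` {w. t \<le> cmod w \<and> cmod w \<le> 1}"

section \<open>Topology of the collar and its cores\<close>

lemma continuous_collar: "S \<subseteq> annulus p r \<Longrightarrow> continuous_on S \<Theta>"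
  using hol holomorphic_on_imp_continuous_on continuous_on_subset by blast

lemma compact_shell: "compact {w::complex. t \<le> cmod w \<and> cmod w \<le> u}"
proof -
  have "{w::complex. t \<le> cmod w \<and> cmod w \<le> u} = cball 0 u - ball 0 t" by auto
  then show ?thesis by (simp add: compact_diff)
qed

lemma open_core: "p < t \<Longrightarrow> open (core t)"
  unfolding core_def
  by (intro open_Diff open_region compact_imp_closed compact_continuous_image continuous_collar compact_shell)
    (use radii in \<open>auto simp: annulus_def\<close>)

lemma open_collar_image: "S \<subseteq> annulus p r \<Longrightarrow> open S \<Longrightarrow> open (\<Theta> ` S)"
  by (intro open_mapping_thm3 holomorphic_on_subset[OF hol] inj_on_subset[OF inj])

text \<open>The image of the inner collar is connected and, by injectivity, misses the frontier. If
  it also missed \<Omega>, the open image of the whole collar would be disjoint from \<Omega> and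
  hence from its closure, although it contains the boundary point \<open>\<Theta> 1\<close>.\<close>

lemma inside:
  assumes "p < cmod w" "cmod w < 1"
  shows "\<Theta> w \<in> \<Omega>"
proof -
  let ?A = "\<Theta> ` annulus p 1"
  have conn: "connected ?A"
    using connected_annulus(1)[of p "0::complex" 1]
    by (intro connected_continuous_image continuous_collar) (use radii in \<open>auto simp: annulus_def\<close>)
  have disj: "?A \<inter> frontier \<Omega> = {}"
  proof -
    have "\<Theta> x \<noteq> \<Theta> y" if "x \<in> annulus p 1" "cmod y = 1" for x y
      using inj_onD[OF inj, of x y] that radii by (auto simp: annulus_def)
    then show ?thesis unfolding boundary[symmetric] by auto
  qed
  have "?A \<inter> \<Omega> \<noteq> {}"
  proof
    assume empty: "?A \<inter> \<Omega> = {}"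
    have "\<Theta> x \<notin> \<Omega>" if "x \<in> annulus p r" for x
    proof (cases "cmod x" "1::real" rule: linorder_cases)
      case less
      then show ?thesis using empty that by (auto simp: annulus_def)
    next
      case equal
      then have "\<Theta> x \<in> frontier \<Omega>" by (simp flip: boundary)
      then show ?thesis using open_region by (auto simp: frontier_def interior_open)
    next
      case greater
      then show ?thesis using outside[of x] that closure_subset[of \<Omega>] by (auto simp: annulus_def)
    qed
    then have "\<Theta> ` annulus p r \<inter> closure \<Omega> = {}"
      using open_Int_closure_eq_empty[OF open_collar_image[OF subset_refl open_annulus]] by auto
    moreover have "\<Theta> 1 \<in> closure \<Omega>" using boundary by (auto simp: frontier_def)
    moreover have "1 \<in> annulus p r" using radii by (auto simp: annulus_def)
    ultimately show False by blast
  qed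
  then have "?A \<subseteq> \<Omega>" using connected_Int_frontier[OF conn, of \<Omega>] disj by blast
  then show ?thesis using assms by (auto simp: annulus_def)
qed

lemma closure_image: "p < cmod w \<Longrightarrow> cmod w \<le> 1 \<Longrightarrow> \<Theta> w \<in> closure \<Omega>"
  using inside[of w] boundary closure_subset[of \<Omega>] 
  by (cases "cmod w = 1") (auto simp: frontier_def)

text \<open>The parameters in a closed shell that are mapped into \<open>K\<close> form a compact
  set off the unit circle, so their moduli stay below some \<open>m < 1\<close>. Any
  \<open>t\<close> beyond \<open>m\<close> and the shell's inner radius works; \<open>u\<close> lets
  the caller force \<open>t\<close> near 1.\<close>

lemma compact_in_core:
  assumes K: "compact K" "K \<subseteq> \<Omega>" and "u < 1"
  obtains t where "u < t" "p < t" "t < 1" "K \<subseteq> core t"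
proof -
  \<comment> \<open>The inner radius of the shell must exceed \<open>p\<close>, so that \<Theta> is
    continuous on the closed shell, and be at least \<open>u\<close>.\<close>
  define a where "a = max u ((p + 1) / 2)"
  have a: "u \<le> a" "p < a" "a < 1" using radii \<open>u < 1\<close> by (auto simp: a_def less_max_iff_disj field_simps)
  define A where "A = {w::complex. a \<le> cmod w \<and> cmod w \<le> 1}"
  define W where "W = A \<inter> \<Theta> -` K"
  have "closedin (top_of_set A) W" unfolding W_def
    using K(1) a radii
    by (intro continuous_closedin_preimage continuous_collar compact_imp_closed) (auto simp: A_def annulus_def)
  then have "compact W"
    using compact_shell[of a 1] unfolding A_def by (rule closedin_compact[rotated])
  have lt: "cmod w < 1" if "w \<in> W" for w
  proof (rule ccontr)
    assume "\<not> cmod w < 1"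
    then have "w \<in> sphere 0 1" using that by (auto simp: W_def A_def)
    then have "\<Theta> w \<in> frontier \<Omega>" unfolding boundary[symmetric] by blast
    then show False using that K open_region by (auto simp: W_def frontier_def interior_open)
  qed
  obtain m where m: "m < 1" "\<And>w. w \<in> W \<Longrightarrow> cmod w \<le> m"
  proof (cases "W = {}")
    case False
    then obtain v where "v \<in> W" "\<forall>w\<in>W. cmod w \<le> cmod v"
      using continuous_attains_sup[OF \<open>compact W\<close> False, of cmod] continuous_on_norm_id by blast
    then show ?thesis using that lt by blast
  qed (use that[of 0] in auto)
  obtain t where t: "max a m < t" "t < 1" using dense[of "max a m" 1] a m by auto
  have "K \<subseteq> core t"
    using K t m(2) by (force simp: core_def W_def A_def)
  then show ?thesis using that[of t] a t by auto
qed

text \<open>The image of \<open>annulus t r\<close> is open and disjoint from the core, so a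
  frontier point avoids it and in particular avoids the frontier of \<Omega>. The point therefore
  lies in \<Omega> but not in the core, and only parameters of modulus exactly \<open>t\<close>
  remain.\<close>

lemma frontier_core:
  assumes t: "p < t" "t < 1"
  shows "frontier (core t) \<subseteq> \<Theta> ` sphere 0 t"
proof
  fix z assume z: "z \<in> frontier (core t)"
  then have zc: "z \<in> closure (core t)" and zn: "z \<notin> core t"
    using open_core[OF t(1)] by (auto simp: frontier_def interior_open)
  have meets: "\<exists>x\<in>U. x \<in> core t" if "open U" "z \<in> U" for U
    using zc that by (auto simp: closure_iff_nhds_not_empty)
  have op: "open (\<Theta> ` annulus t r)"
    using t by (intro open_collar_image open_annulus) (auto simp: annulus_def)
  have disj: "\<Theta> ` annulus t r \<inter> core t = {}"
  proof -
    have "\<Theta> w \<notin> core t" if "w \<in> annulus t r" for w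
    proof (cases "cmod w \<le> 1")
      case False
      then show ?thesis using outside[of w] that closure_subset[of \<Omega>] by (auto simp: core_def annulus_def)
    qed (use that in \<open>auto simp: core_def annulus_def\<close>)
    then show ?thesis by auto
  qed
  have "z \<notin> \<Theta> ` annulus t r" using meets[OF op] disj by blast
  moreover have "z \<in> closure \<Omega>" using zc closure_mono[of "core t" \<Omega>] by (auto simp: core_def)
  then have "z \<in> \<Omega> \<or> z \<in> \<Theta> ` sphere 0 1" using open_region boundary by (auto simp: frontier_def interior_open)
  moreover have "sphere 0 1 \<subseteq> annulus t r" using t radii by (auto simp: annulus_def)
  ultimately have "z \<in> \<Omega>" by blast
  then obtain w where w: "z = \<Theta> w" "t \<le> cmod w" "cmod w \<le> 1" using zn by (auto simp: core_def)
  moreover have "w \<notin> annulus t r" using w \<open>z \<notin> \<Theta> ` annulus t r\<close> by blast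
  ultimately have "cmod w = t" using radii by (auto simp: annulus_def)
  then show "z \<in> \<Theta> ` sphere 0 t" using w by auto
qed

lemma core_max:
  assumes F: "F holomorphic_on \<Omega>" and t: "p < t" "t < 1"
    and M: "\<And>w. cmod w = t \<Longrightarrow> cmod (F (\<Theta> w)) \<le> M" and z: "z \<in> core t"
  shows "cmod (F z) \<le> M"
proof (rule maximum_modulus_frontier[OF _ _ _ _ z])
  have sub: "\<Theta> ` sphere 0 t \<subseteq> \<Omega>" using inside t by auto
  have "closure (core t) \<subseteq> \<Omega>"
    using frontier_core[OF t] sub by (auto simp: closure_Un_frontier core_def)
  then show "continuous_on (closure (core t)) F"
    using F continuous_on_subset holomorphic_on_imp_continuous_on by blast
  show "F holomorphic_on interior (core t)"
    using F by (rule holomorphic_on_subset) (use interior_subset in \<open>auto simp: core_def\<close>)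
  show "bounded (core t)" using bounded_region by (rule bounded_subset) (auto simp: core_def)
  show "\<And>z. z \<in> frontier (core t) \<Longrightarrow> cmod (F z) \<le> M" using frontier_core[OF t] M by auto
qed

text \<open>Nonnegative indices suffice: the function is real, so opposite coefficients are
  conjugate.\<close>

definition Re_coeff :: "(complex \<Rightarrow> complex) \<Rightarrow> nat \<Rightarrow> complex" where
  "Re_coeff F n = circ_coeff (\<lambda>w. of_real (Re (F (\<Theta> w)))) 1 (int n)"

section \<open>Holomorphic functions pulled back to the collar\<close>

lemma hol_pullback: "F holomorphic_on \<Omega> \<Longrightarrow> (\<lambda>w. F (\<Theta> w)) holomorphic_on annulus p 1"
  using inside radii
  by (intro holomorphic_on_compose_gen[of \<Theta> _ F \<Omega>, unfolded o_def] holomorphic_on_subset[OF hol])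
    (auto simp: annulus_def)

lemma cont_pullback:
  "continuous_on (closure \<Omega>) F \<Longrightarrow> continuous_on {w. p < cmod w \<and> cmod w \<le> 1} (\<lambda>w. F (\<Theta> w))"
  using closure_image radii
  by (intro continuous_on_compose2[of _ F _ \<Theta>] continuous_collar) (auto simp: annulus_def)

lemma cont_pullback_sphere:
  "F holomorphic_on \<Omega> \<Longrightarrow> p < t \<Longrightarrow> t < 1 \<Longrightarrow> continuous_on (sphere 0 t) (\<lambda>w. F (\<Theta> w))"
  by (intro holomorphic_on_imp_continuous_on holomorphic_on_subset[OF hol_pullback])
    (auto simp: annulus_def)

text \<open>The hypothesis \<open>anti\<close> says that the real part formally vanishes on the unit
  circle; it is stated at radius \<open>q\<close> because \<open>F\<close> comes without boundary
  values. The bound on \<bar>Re F\<bar> over circles tends to zero at the boundary and passes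
  inwards by the maximum principle.\<close>

lemma Re_zero_of_antisymmetric:
  assumes F: "F holomorphic_on \<Omega>" and q: "p < q" "q < 1"
    and anti: "\<And>n. circ_coeff (\<lambda>w. F (\<Theta> w)) q (int n) = - of_real (q ^ (2 * n)) * cnj (circ_coeff (\<lambda>w. F (\<Theta> w)) q (- int n))"
    and z: "z \<in> \<Omega>"
  shows "Re (F z) = 0"
proof -
  have "compact ((\<lambda>w. F (\<Theta> w)) ` sphere 0 q)"
    using F q by (intro compact_continuous_image cont_pullback_sphere) auto
  then obtain M where M: "\<And>w. cmod w = q \<Longrightarrow> cmod (F (\<Theta> w)) \<le> M"
    by (fastforce dest!: compact_imp_bounded simp: bounded_iff)
  define d where "d t = M * ((q / t) / (1 - q / t) - q * t / (1 - q * t))" for t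
  have "\<bar>Re (F z)\<bar> \<le> e" if "e > 0" for e
  proof -
    \<comment> \<open>At \<open>t = 1\<close> the two fractions in \<open>d\<close> cancel, so
      \<open>d 1 = 0\<close>.\<close>
    have "(d \<longlongrightarrow> d 1) (at_left 1)"
      unfolding d_def using q radii by (intro tendsto_intros) auto
    then have "\<forall>\<^sub>F t in at_left 1. d t < e"
      by (rule order_tendstoD(2)) (use \<open>e > 0\<close> in \<open>simp add: d_def\<close>)
    then obtain b where b: "b < 1" "\<And>t. b < t \<Longrightarrow> t < 1 \<Longrightarrow> d t < e"
      unfolding eventually_at_left_field by blast
    obtain t where t: "max b q < t" "p < t" "t < 1" "{z} \<subseteq> core t"
      using compact_in_core[of "{z}" "max b q"] z b q by auto
    have bd: "\<bar>Re (F (\<Theta> w))\<bar> \<le> e" if "cmod w = t" for w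
      using Re_bound_of_antisymmetric[OF hol_pullback[OF F] radii(1) q M anti _ _ that] t b(2)[of t]
      by (simp add: d_def)
    \<comment> \<open>The maximum principle is available for moduli only; \<open>exp (F z)\<close>
      and \<open>exp (- F z)\<close> convert it into upper and lower bounds for the real
      part.\<close>
    have "cmod (exp (F z)) \<le> exp e"
      by (rule core_max[of "\<lambda>z. exp (F z)" t])
        (use t bd in \<open>auto intro!: holomorphic_intros F simp: abs_le_iff\<close>)
    moreover have "cmod (exp (- F z)) \<le> exp e"
      by (rule core_max[of "\<lambda>z. exp (- F z)" t])
        (use t bd in \<open>auto intro!: holomorphic_intros F simp: abs_le_iff\<close>)
    ultimately show ?thesis by (simp add: abs_le_iff)
  qed
  then show ?thesis using field_le_epsilon[of "\<bar>Re (F z)\<bar>" 0] by fastforce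
qed

text \<open>A nonconstant \<open>F\<close> would be open, so its image would contain a point to the
  right of \<open>F z0\<close>, off the imaginary axis.\<close>

lemma constant_of_Re_zero:
  assumes F: "F holomorphic_on \<Omega>" and Re: "\<And>z. z \<in> \<Omega> \<Longrightarrow> Re (F z) = 0" and "z \<in> \<Omega>" "z0 \<in> \<Omega>"
  shows "F z = F z0"
proof (rule ccontr)
  assume "F z \<noteq> F z0"
  then have "\<not> F constant_on \<Omega>" using assms(3,4) unfolding constant_on_def by metis
  then have "open (F ` \<Omega>)"
    using open_mapping_thm[OF F open_region connected_region open_region] by auto
  then obtain e where e: "e > 0" "ball (F z0) e \<subseteq> F ` \<Omega>"
    using \<open>z0 \<in> \<Omega>\<close> unfolding open_contains_ball by blast
  have "F z0 + of_real (e / 2) \<in> ball (F z0) e" using e by (simp add: dist_norm)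
  then obtain y where "y \<in> \<Omega>" "F y = F z0 + of_real (e / 2)" using e by force
  then show False using Re[of y] Re[of z0] \<open>z0 \<in> \<Omega>\<close> e by auto
qed

section \<open>The compactness argument on an inner circle\<close>

lemma extremal_rescaling:
  assumes F: "F holomorphic_on \<Omega>" "continuous_on (closure \<Omega>) F" and q: "p < q" "q < 1"
    and B: "\<And>n. cmod (Re_coeff F n) \<le> B * \<omega> n" and "\<omega> 0 > 0"
    and large: "cmod w = q" "real (Suc k) * B < cmod (F (\<Theta> w))" and \<omega>: "\<And>n. 0 \<le> \<omega> n"
  obtains c v where "c > 0" "cmod v = q" "cmod (of_real c * F (\<Theta> v)) = 1"
    "\<And>w. cmod w = q \<Longrightarrow> cmod (of_real c * F (\<Theta> w)) \<le> 1"
    "\<And>n. cmod (Re_coeff (\<lambda>z. of_real c * F z) n) \<le> \<omega> n / real (Suc k)"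
proof -
  have "B \<ge> 0" using order_trans[OF norm_ge_zero B[of 0]] \<open>\<omega> 0 > 0\<close> by (simp add: zero_le_mult_iff)
  have "w \<in> sphere 0 q" using large by simp
  then obtain v where v: "cmod v = q" "\<And>w. cmod w = q \<Longrightarrow> cmod (F (\<Theta> w)) \<le> cmod (F (\<Theta> v))"
    using continuous_attains_sup[of "sphere 0 q" "\<lambda>w. cmod (F (\<Theta> w))"]
      continuous_on_norm[OF cont_pullback_sphere[OF F(1) q]] by auto
  \<comment> \<open>Dividing by the maximum on the circle makes it 1, and the assumed violation
    gives \<open>B / m < 1 / real (Suc k)\<close>, so the real-part coefficients become
    small.\<close>
  define m where "m = cmod (F (\<Theta> v))"
  have m: "real (Suc k) * B < m" using v(2)[OF large(1)] large(2) by (simp add: m_def)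
  have "0 \<le> real (Suc k) * B" using \<open>B \<ge> 0\<close> by simp
  then have m0: "m > 0" using m by linarith
  show thesis
  proof (rule that[of "1 / m" v])
    fix n
    have "Re_coeff (\<lambda>z. of_real (1 / m) * F z) n = of_real (1 / m) * Re_coeff F n"
      unfolding Re_coeff_def by (simp flip: circ_coeff_cmult)
    then have "cmod (Re_coeff (\<lambda>z. of_real (1 / m) * F z) n) \<le> B * \<omega> n / m"
      using B[of n] m0 by (simp add: norm_mult norm_divide divide_right_mono)
    also have "\<dots> \<le> \<omega> n / real (Suc k)"
      using mult_right_mono[OF less_imp_le[OF m] \<omega>[of n]] m0 by (simp add: field_simps)
    finally show "cmod (Re_coeff (\<lambda>z. of_real (1 / m) * F z) n) \<le> \<omega> n / real (Suc k)" .
  qed (use v m0 in \<open>auto simp: m_def norm_mult norm_divide\<close>)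
qed

text \<open>The weight \<open>\<omega>\<close> will be a power of \<open>freq_weight\<close>; its
  summability against \<open>t ^ n\<close> gives the local bounds for Montel's theorem. The
  condition at \<open>z0\<close> excludes nonzero imaginary constants, whose real-part coefficients
  all vanish.\<close>

proposition inner_circle_bound:
  assumes z0: "z0 \<in> \<Omega>" and q: "p < q" "q < 1"
    and \<omega>: "\<And>n. 0 < \<omega> n" "\<And>t. 0 < t \<Longrightarrow> t < 1 \<Longrightarrow> summable (\<lambda>n. \<omega> n * t ^ n)"
  shows "\<exists>C>0. \<forall>F B w. F holomorphic_on \<Omega> \<longrightarrow> continuous_on (closure \<Omega>) F \<longrightarrow> Im (F z0) = 0 \<longrightarrow>
      (\<forall>n. cmod (Re_coeff F n) \<le> B * \<omega> n) \<longrightarrow> cmod w = q \<longrightarrow> cmod (F (\<Theta> w)) \<le> C * B"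
    (is "\<exists>C>0. ?P C")
proof (rule ccontr)
  assume contra: "\<not> (\<exists>C>0. ?P C)"
  have q0: "q > 0" using radii q by simp
  have "\<exists>G v. G holomorphic_on \<Omega> \<and> continuous_on (closure \<Omega>) G \<and> Im (G z0) = 0 \<and>
      cmod v = q \<and> cmod (G (\<Theta> v)) = 1 \<and> (\<forall>w. cmod w = q \<longrightarrow> cmod (G (\<Theta> w)) \<le> 1) \<and>
      (\<forall>n. cmod (Re_coeff G n) \<le> \<omega> n / real (Suc k))" for k
  proof -
    have "\<not> ?P (real (Suc k))" using contra of_nat_0_less_iff zero_less_Suc by blast
    then obtain F B w where F: "F holomorphic_on \<Omega>" "continuous_on (closure \<Omega>) F" "Im (F z0) = 0"
      "\<And>n. cmod (Re_coeff F n) \<le> B * \<omega> n" and w: "cmod w = q" "\<not> cmod (F (\<Theta> w)) \<le> real (Suc k) * B"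
      by blast
    obtain c v where c: "c > 0" "cmod v = q" "cmod (of_real c * F (\<Theta> v)) = 1"
      "\<And>w. cmod w = q \<Longrightarrow> cmod (of_real c * F (\<Theta> w)) \<le> 1"
      "\<And>n. cmod (Re_coeff (\<lambda>z. of_real c * F z) n) \<le> \<omega> n / real (Suc k)"
      using extremal_rescaling[OF F(1,2) q F(4) \<omega>(1) w(1) _ less_imp_le[OF \<omega>(1)], of k] w(2)
      by (metis not_le)
    show ?thesis
      by (rule exI[of _ "\<lambda>z. of_real c * F z"], rule exI[of _ v])
        (use F c in \<open>auto intro!: holomorphic_intros continuous_intros\<close>)
  qed
  then obtain G v where G: "\<And>k. G k holomorphic_on \<Omega>" "\<And>k. continuous_on (closure \<Omega>) (G k)"
      "\<And>k. Im (G k z0) = 0" "\<And>k. cmod (v k) = q" "\<And>k. cmod (G k (\<Theta> (v k))) = 1"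
      "\<And>k w. cmod w = q \<Longrightarrow> cmod (G k (\<Theta> w)) \<le> 1"
      "\<And>k n. cmod (Re_coeff (G k) n) \<le> \<omega> n / real (Suc k)"
    by metis
  \<comment> \<open>Local boundedness: \<open>K\<close> lies in a core with \<open>t > q\<close>,
    and on the circle of radius \<open>t\<close> the Laurent estimate with \<open>M = 1\<close> is
    uniform in \<open>k\<close>.\<close>
  have bdd: "\<exists>L. \<forall>h\<in>range G. \<forall>z\<in>K. cmod (h z) \<le> L" if K: "compact K" "K \<subseteq> \<Omega>" for K
  proof -
    obtain t where t: "q < t" "p < t" "t < 1" "K \<subseteq> core t"
      using compact_in_core[OF K q(2)] .
    have "cmod (G k (\<Theta> w)) \<le> (\<Sum>n. (2 * \<omega> n + 1 * q ^ n) * t ^ n) + (\<Sum>n. 1 * (q / t) ^ Suc n)"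
      if "cmod w = t" for k w
    proof (rule annulus_bound_of_Re[OF cont_pullback[OF G(2)] hol_pullback[OF G(1)] radii(1) q G(6) _ _ t(1,3) that])
      fix n
      have "\<omega> n / real (Suc k) \<le> \<omega> n" using \<omega>(1)[of n] by (simp add: divide_le_eq)
      then show "cmod (circ_coeff (\<lambda>w. of_real (Re (G k (\<Theta> w)))) 1 (int n)) \<le> \<omega> n"
        using G(7)[where k = k and n = n] unfolding Re_coeff_def by linarith
    qed (use t q0 \<omega> in auto)
    then have "cmod (G k z) \<le> (\<Sum>n. (2 * \<omega> n + 1 * q ^ n) * t ^ n) + (\<Sum>n. 1 * (q / t) ^ Suc n)"
      if "z \<in> K" for k z
      by (rule core_max[OF G(1) t(2,3)]) (use t(4) that in auto)
    then show ?thesis by blast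
  qed
  obtain g \<sigma> where g: "g holomorphic_on \<Omega>" "strict_mono (\<sigma> :: nat \<Rightarrow> nat)"
     and pt: "\<And>x. x \<in> \<Omega> \<Longrightarrow> (\<lambda>k. G (\<sigma> k) x) \<longlonglongrightarrow> g x"
     and uni: "\<And>K. compact K \<Longrightarrow> K \<subseteq> \<Omega> \<Longrightarrow> uniform_limit K (G \<circ> \<sigma>) g sequentially"
  proof (rule Montel[where \<F> = G and \<H> = "range G", OF open_region])
    show "\<And>h. h \<in> range G \<Longrightarrow> h holomorphic_on \<Omega>" using G(1) by auto
    show "\<And>K. compact K \<Longrightarrow> K \<subseteq> \<Omega> \<Longrightarrow> \<exists>L. \<forall>h\<in>range G. \<forall>z\<in>K. cmod (h z) \<le> L"
      by (rule bdd)
    show "range G \<subseteq> range G" ..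
  qed (rule that)
  have "uniform_limit (\<Theta> ` sphere 0 q) (G \<circ> \<sigma>) g sequentially"
    using q radii inside
    by (intro uni compact_continuous_image continuous_collar) (auto simp: annulus_def)
  then have lim: "uniform_limit (sphere 0 q) (\<lambda>k w. G (\<sigma> k) (\<Theta> w)) (\<lambda>w. g (\<Theta> w)) sequentially"
    unfolding uniform_limit_iff by simp
  have coeff_lim: "(\<lambda>k. circ_coeff (\<lambda>w. G (\<sigma> k) (\<Theta> w)) q n) \<longlonglongrightarrow> circ_coeff (\<lambda>w. g (\<Theta> w)) q n" for n
    using q0 q by (intro circ_coeff_uniform_limit[OF lim] cont_pullback_sphere G) auto
  have "circ_coeff (\<lambda>w. g (\<Theta> w)) q (int n) = - of_real (q ^ (2 * n)) * cnj (circ_coeff (\<lambda>w. g (\<Theta> w)) q (- int n))" for n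
  proof -
    \<comment> \<open>The coefficient formula for the real part is moved from the unit circle to
      radius \<open>q\<close>, where the sequence converges uniformly.\<close>
    have eq: "circ_coeff (\<lambda>w. G k (\<Theta> w)) q (int n) + q ^ (2 * n) * cnj (circ_coeff (\<lambda>w. G k (\<Theta> w)) q (- int n)) =
       2 * q ^ n * Re_coeff (G k) n" for k
    proof -
      note l = circ_coeff_limit[OF cont_pullback[OF G(2)] hol_pullback[OF G(1)] radii(1) q]
      have "continuous_on (sphere 0 1) (\<lambda>w. G k (\<Theta> w))"
        using radii by (intro continuous_on_subset[OF cont_pullback[OF G(2)]]) auto
      then show ?thesis
        unfolding Re_coeff_def l using q0
        by (subst circ_coeff_Re)
          (auto simp: power_int_minus field_simps power2_eq_square power_mult)
    qed
    have "(\<lambda>k. Re_coeff (G (\<sigma> k)) n) \<longlonglongrightarrow> 0"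
    proof (rule Lim_null_comparison)
      show "\<forall>\<^sub>F k in sequentially. cmod (Re_coeff (G (\<sigma> k)) n) \<le> \<omega> n * inverse (real (Suc (\<sigma> k)))"
        using G(7) by (intro always_eventually allI) (simp only: divide_inverse[symmetric])
      show "(\<lambda>k. \<omega> n * inverse (real (Suc (\<sigma> k)))) \<longlonglongrightarrow> 0"
        using tendsto_mult_left[OF LIMSEQ_subseq_LIMSEQ[OF LIMSEQ_inverse_real_of_nat g(2)], of "\<omega> n"]
        by (simp add: o_def)
    qed
    then have "(\<lambda>k. 2 * q ^ n * Re_coeff (G (\<sigma> k)) n) \<longlonglongrightarrow> 0"
      by (rule tendsto_mult_right_zero)
    moreover have "(\<lambda>k. 2 * q ^ n * Re_coeff (G (\<sigma> k)) n) \<longlonglongrightarrow>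
       circ_coeff (\<lambda>w. g (\<Theta> w)) q (int n) + q ^ (2 * n) * cnj (circ_coeff (\<lambda>w. g (\<Theta> w)) q (- int n))"
      unfolding eq[symmetric] by (intro tendsto_intros coeff_lim)
    ultimately have "circ_coeff (\<lambda>w. g (\<Theta> w)) q (int n) + q ^ (2 * n) * cnj (circ_coeff (\<lambda>w. g (\<Theta> w)) q (- int n)) = 0"
      using LIMSEQ_unique by fastforce
    then show ?thesis by (simp add: eq_neg_iff_add_eq_0)
  qed
  then have Re0: "Re (g z) = 0" if "z \<in> \<Omega>" for z
    using Re_zero_of_antisymmetric[OF g(1) q _ that] by blast
  \<comment> \<open>The normalization at \<open>z0\<close> survives the limit and makes the
    imaginary constant \<open>g\<close> zero.\<close>
  have "(\<lambda>k. Im (G (\<sigma> k) z0)) \<longlonglongrightarrow> Im (g z0)" by (intro tendsto_intros pt z0)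
  then have "Im (g z0) = 0" using G(3) by (simp add: LIMSEQ_const_iff)
  then have zero: "g z = 0" if "z \<in> \<Omega>" for z
    using constant_of_Re_zero[OF g(1) Re0 that z0] Re0[OF z0] by (simp add: complex_eq_iff)
  \<comment> \<open>The points \<open>v (\<sigma> k)\<close> of modulus-one values move with
    \<open>k\<close>, so the contradiction uses uniform convergence on the circle.\<close>
  have "\<forall>\<^sub>F k in sequentially. \<forall>w\<in>sphere 0 q. dist (G (\<sigma> k) (\<Theta> w)) (g (\<Theta> w)) < 1"
    using lim unfolding uniform_limit_iff by (meson zero_less_one)
  then obtain k where "\<forall>w\<in>sphere 0 q. dist (G (\<sigma> k) (\<Theta> w)) (g (\<Theta> w)) < 1"
    by (auto dest: eventually_happens)
  moreover have "v (\<sigma> k) \<in> sphere 0 q" using G(4) by simp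
  moreover have "g (\<Theta> (v (\<sigma> k))) = 0" using zero inside G(4) q by simp
  ultimately show False using G(5)[of "\<sigma> k"] by fastforce
qed

end

section \<open>Sobolev norms\<close>

lemma freq_weight_pos: "freq_weight n > 0"
  by (simp add: freq_weight_def less_max_iff_disj)

text \<open>For \<open>n \<ge> 1\<close> the maximum in the weight is \<open>2 * pi * n\<close>, and
  exponential decay beats any power.\<close>

lemma summable_freq_weight_geometric:
  assumes "0 < t" "t < 1"
  shows "summable (\<lambda>n. freq_weight (int n) powr \<alpha> * t ^ n)"
proof (rule summable_comparison_test_bigo)
  define c where "c = - ln t"
  have c: "c > 0" using assms by (simp add: c_def)
  have t: "t = exp (- c)" using assms by (simp add: c_def)
  have "(\<lambda>n. (2 * pi * real n) powr \<alpha> * exp (- c * real n)) \<in> O(\<lambda>n. 1 / real n ^ 2)"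
    using c by real_asymp
  moreover have "\<forall>\<^sub>F n in sequentially. freq_weight (int n) powr \<alpha> * t ^ n = (2 * pi * real n) powr \<alpha> * exp (- c * real n)"
  proof (intro eventually_sequentiallyI[of 1])
    fix n :: nat assume "1 \<le> n"
    then have "2 * pi * real n \<ge> 1 * 1" using pi_gt3 by (intro mult_mono) auto
    then show "freq_weight (int n) powr \<alpha> * t ^ n = (2 * pi * real n) powr \<alpha> * exp (- c * real n)"
      by (simp add: freq_weight_def t max_absorb1 mult.commute flip: exp_of_nat_mult)
  qed
  ultimately show "(\<lambda>n. freq_weight (int n) powr \<alpha> * t ^ n) \<in> O(\<lambda>n. 1 / real n ^ 2)"
    by (subst landau_o.big.in_cong) auto
  show "summable (\<lambda>n. norm (1 / real n ^ 2))"
    using inverse_power_summable[of 2, where 'a = real] by (simp add: inverse_eq_divide)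
qed

lemma summable_on_int:
  fixes f :: "int \<Rightarrow> real"
  assumes "summable (\<lambda>n. f (int n))" "summable (\<lambda>n. f (- int n))" "\<And>n. 0 \<le> f n"
  shows "f summable_on UNIV"
proof -
  have "f summable_on range int" "f summable_on range (\<lambda>n. - int n)"
    using assms
    by (auto simp: summable_on_reindex inj_def o_def intro!: norm_summable_imp_summable_on)
  then have "f summable_on (range int \<union> range (\<lambda>n. - int n))" by (rule summable_on_union)
  moreover have "n \<in> range int \<union> range (\<lambda>n. - int n)" for n
    by (cases n rule: int_cases2) auto
  then have "range int \<union> range (\<lambda>n. - int n) = UNIV" by blast
  ultimately show ?thesis by simp
qed

text \<open>Each coefficient of the imaginary part is at most that of the real part plus
  \<open>C * B * q ^ nat \<bar>n\<bar>\<close>, with \<open>B\<close> the norm of the real part;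
  squares are then summed. Summability is part of the conclusion because \<open>sobolev_norm\<close>
  is infinite without it.\<close>

theorem (in collar) conjugate_estimate:
  assumes z0: "z0 \<in> \<Omega>"
  defines "U F s n \<equiv> (cmod (circ_coeff (\<lambda>w. of_real (Re (F (\<Theta> w)))) 1 n))\<^sup>2 * freq_weight n powr (2 * s)"
    and "V F s n \<equiv> (cmod (circ_coeff (\<lambda>w. of_real (Im (F (\<Theta> w)))) 1 n))\<^sup>2 * freq_weight n powr (2 * s)"
  shows "\<exists>D>0. \<forall>F. F holomorphic_on \<Omega> \<longrightarrow> continuous_on (closure \<Omega>) F \<longrightarrow> Im (F z0) = 0 \<longrightarrow>
     U F s summable_on UNIV \<longrightarrow> V F s summable_on UNIV \<and> infsum (V F s) UNIV \<le> D\<^sup>2 * infsum (U F s) UNIV"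
proof -
  define q where "q = (p + 1) / 2"
  have q: "p < q" "q < 1" "q > 0" using radii by (auto simp: q_def)
  have q2: "0 < q\<^sup>2" "q\<^sup>2 < 1" using q by (auto simp: power_less_one_iff)
  have "\<exists>C>0. \<forall>F B w. F holomorphic_on \<Omega> \<longrightarrow> continuous_on (closure \<Omega>) F \<longrightarrow> Im (F z0) = 0 \<longrightarrow>
      (\<forall>n. cmod (Re_coeff F n) \<le> B * freq_weight (int n) powr (- s)) \<longrightarrow> cmod w = q \<longrightarrow> cmod (F (\<Theta> w)) \<le> C * B"
    using freq_weight_pos q
    by (intro inner_circle_bound z0 summable_freq_weight_geometric) (auto simp: less_imp_neq[symmetric])
  then obtain C where C: "C > 0" "\<And>F B w. \<lbrakk>F holomorphic_on \<Omega>; continuous_on (closure \<Omega>) F; Im (F z0) = 0;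
      \<And>n. cmod (Re_coeff F n) \<le> B * freq_weight (int n) powr (- s); cmod w = q\<rbrakk> \<Longrightarrow> cmod (F (\<Theta> w)) \<le> C * B"
    by blast
  define E where "E n = (q ^ nat \<bar>n\<bar>)\<^sup>2 * freq_weight n powr (2 * s)" for n
  have E: "E summable_on UNIV"
  proof (rule summable_on_int)
    show "summable (\<lambda>n. E (int n))"
      using summable_freq_weight_geometric[OF q2, of "2 * s"] unfolding E_def
      by (simp add: mult.commute flip: power_mult)
    then show "summable (\<lambda>n. E (- int n))"
      by (simp add: E_def freq_weight_def)
  qed (simp add: E_def)
  define S where "S = infsum E UNIV"
  have "S \<ge> 0" unfolding S_def by (rule infsum_nonneg) (simp add: E_def)
  \<comment> \<open>The constant results from
    \<open>(x + y)\<^sup>2 \<le> 2 * x\<^sup>2 + 2 * y\<^sup>2\<close>; the geometric remainder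
    contributes the sum \<open>S\<close>.\<close>
  define D where "D = sqrt (2 + 2 * C\<^sup>2 * S)"
  have pos: "2 + 2 * C\<^sup>2 * S > 0" using \<open>S \<ge> 0\<close> by (simp add: add_pos_nonneg)
  then have "D > 0" by (simp add: D_def)
  moreover have "V F s summable_on UNIV \<and> infsum (V F s) UNIV \<le> D\<^sup>2 * infsum (U F s) UNIV"
    if F: "F holomorphic_on \<Omega>" "continuous_on (closure \<Omega>) F" "Im (F z0) = 0"
      and summ: "U F s summable_on UNIV" for F
  proof -
    let ?u = "circ_coeff (\<lambda>w. of_real (Re (F (\<Theta> w)))) 1"
    let ?v = "circ_coeff (\<lambda>w. of_real (Im (F (\<Theta> w)))) 1"
    let ?a = "circ_coeff (\<lambda>w. F (\<Theta> w)) 1"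
    define B where "B = sqrt (infsum (U F s) UNIV)"
    have U0: "U F s n \<ge> 0" for n by (simp add: U_def)
    have B2: "B\<^sup>2 = infsum (U F s) UNIV" and "B \<ge> 0"
      using infsum_nonneg[of UNIV "U F s"] U0 by (auto simp: B_def)
    \<comment> \<open>One term of the series is at most the whole sum; this supplies the weight
      \<open>freq_weight n powr (- s)\<close> for the inner-circle bound.\<close>
    have uB: "cmod (?u n) \<le> B * freq_weight n powr (- s)" for n
    proof -
      have "(freq_weight n powr s)\<^sup>2 = freq_weight n powr (2 * s)"
        unfolding power2_eq_square mult_2 powr_add ..
      then have "(cmod (?u n) * freq_weight n powr s)\<^sup>2 = infsum (U F s) {n}"
        by (simp add: U_def power_mult_distrib)
      also have "\<dots> \<le> B\<^sup>2" unfolding B2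
        using summ U0 by (intro infsum_mono_neutral) auto
      finally have "cmod (?u n) * freq_weight n powr s \<le> B"
        using \<open>B \<ge> 0\<close> by (rule power2_le_imp_le)
      then show ?thesis using freq_weight_pos[of n] by (simp add: powr_minus field_simps)
    qed
    have CB: "cmod (F (\<Theta> w)) \<le> C * B" if "cmod w = q" for w
      using C(2)[OF F, of B w] uB that by (simp add: Re_coeff_def)
    note neg = norm_circ_coeff_neg_le[OF cont_pullback[OF F(2)] hol_pullback[OF F(1)] radii(1) q(1,2) CB]
    have c1: "continuous_on (sphere 0 1) (\<lambda>w. F (\<Theta> w))"
      using radii by (intro continuous_on_subset[OF cont_pullback[OF F(2)]]) auto
    have ub: "?u n = (?a n + cnj (?a (- n))) / 2" and vb: "?v n = (?a n - cnj (?a (- n))) / (2 * \<i>)" for n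
      using c1 by (auto simp: circ_coeff_Re circ_coeff_Im)
    \<comment> \<open>For either sign of \<open>n\<close>, one of \<open>?a n\<close> and
      \<open>?a (- n)\<close> has index at most 0 and decays geometrically; the other is eliminated
      in favour of \<open>?u n\<close>.\<close>
    have v: "cmod (?v n) \<le> cmod (?u n) + C * B * q ^ nat \<bar>n\<bar>" for n
    proof (cases "n \<ge> 0")
      case True
      have "\<i> * ?v n = ?u n - cnj (?a (- n))" unfolding ub vb by (simp add: field_simps)
      then have "cmod (?v n) \<le> cmod (?u n) + cmod (?a (- n))"
        using norm_triangle_ineq4[of "?u n" "cnj (?a (- n))"] by (metis complex_mod_cnj mult_1 norm_ii norm_mult)
      then show ?thesis using neg[of "nat n"] True by simp
    next
      case False
      have "\<i> * ?v n = ?a n - ?u n" unfolding ub vb by (simp add: field_simps)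
      then have "cmod (?v n) \<le> cmod (?a n) + cmod (?u n)"
        using norm_triangle_ineq4[of "?a n" "?u n"] by (metis mult_1 norm_ii norm_mult)
      then show ?thesis using neg[of "nat (- n)"] False by simp
    qed
    have VU: "V F s n \<le> 2 * U F s n + 2 * C\<^sup>2 * B\<^sup>2 * E n" for n
    proof -
      have "(cmod (?v n))\<^sup>2 \<le> (cmod (?u n) + C * B * q ^ nat \<bar>n\<bar>)\<^sup>2"
        using v by (intro power_mono) auto
      also have "\<dots> \<le> 2 * (cmod (?u n))\<^sup>2 + 2 * (C * B * q ^ nat \<bar>n\<bar>)\<^sup>2"
        using sum_squares_bound[of "cmod (?u n)" "C * B * q ^ nat \<bar>n\<bar>"] by (simp add: power2_sum)
      finally have "V F s n \<le> (2 * (cmod (?u n))\<^sup>2 + 2 * (C * B * q ^ nat \<bar>n\<bar>)\<^sup>2) * freq_weight n powr (2 * s)"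
        unfolding V_def by (intro mult_right_mono) auto
      then show ?thesis by (simp add: U_def E_def algebra_simps power_mult_distrib)
    qed
    have sums: "(\<lambda>n. 2 * U F s n + 2 * C\<^sup>2 * B\<^sup>2 * E n) summable_on UNIV"
      by (intro summable_on_add summable_on_cmult_right summ E)
    have V: "V F s summable_on UNIV"
      using sums by (rule summable_on_comparison_test) (use VU in \<open>auto simp: V_def\<close>)
    have "infsum (V F s) UNIV \<le> (\<Sum>\<^sub>\<infinity>n\<in>UNIV. 2 * U F s n + 2 * C\<^sup>2 * B\<^sup>2 * E n)"
      using V sums VU by (intro infsum_mono) auto
    also have "\<dots> = 2 * B\<^sup>2 + 2 * C\<^sup>2 * B\<^sup>2 * S"
      unfolding B2 S_def
      using summ E by (subst infsum_add) (auto intro!: summable_on_cmult_right simp: infsum_cmult_right')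
    also have "\<dots> = D\<^sup>2 * infsum (U F s) UNIV"
      using pos by (simp add: D_def B2 algebra_simps)
    finally show ?thesis using V by simp
  qed
  ultimately show ?thesis by blast
qed

section \<open>From the dipole method to the collar estimate\<close>

lemma fourier_coeff_eq_circ_coeff:
  "fourier_coeff \<Psi> \<rho> G n = circ_coeff (\<lambda>w. of_real (G (\<Psi> (of_real \<rho> * w)))) 1 n"
  by (simp add: fourier_coeff_def circ_coeff_def boundary_param_def)

lemma collar_of_peripheral_map:
  assumes "open \<Omega>" "connected \<Omega>" "bounded \<Omega>"
    and P: "peripheral_conformal_map (frontier \<Omega>) \<rho> \<kappa> \<Psi>"
    and out: "\<And>z. \<rho> < cmod z \<Longrightarrow> cmod z \<le> \<kappa> * \<rho> \<Longrightarrow> \<Psi> z \<notin> closure \<Omega>"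
  shows "collar \<Omega> (\<lambda>w. \<Psi> (of_real \<rho> * w)) (1 / \<kappa>) \<kappa>"
proof
  let ?A = "{z. \<rho> / \<kappa> \<le> cmod z \<and> cmod z \<le> \<kappa> * \<rho>}"
  have \<rho>: "\<rho> > 0" and \<kappa>: "\<kappa> > 1" and im: "\<Psi> ` sphere 0 \<rho> = frontier \<Omega>"
    and an: "\<Psi> analytic_on ?A" and inj: "inj_on \<Psi> ?A"
    using P unfolding peripheral_conformal_map_def by auto
  show "0 \<le> 1 / \<kappa>" "1 / \<kappa> < 1" "1 < \<kappa>" using \<kappa> by auto
  have sub: "(*) (of_real \<rho>) ` annulus (1 / \<kappa>) \<kappa> \<subseteq> ?A"
    using \<rho> \<kappa> by (auto simp: annulus_def norm_mult field_simps)
  show "(\<lambda>w. \<Psi> (of_real \<rho> * w)) holomorphic_on annulus (1 / \<kappa>) \<kappa>"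
    using holomorphic_on_compose_gen[OF _ analytic_imp_holomorphic[OF an] sub]
    by (auto simp: o_def intro!: holomorphic_intros)
  show "inj_on (\<lambda>w. \<Psi> (of_real \<rho> * w)) (annulus (1 / \<kappa>) \<kappa>)"
    using inj sub \<rho> unfolding inj_on_def by (metis (no_types, lifting) image_subset_iff mult_left_cancel of_real_eq_0_iff order_less_irrefl)
  have "(*) (of_real \<rho>) ` sphere 0 1 = sphere (0::complex) \<rho>"
  proof
    show "sphere 0 \<rho> \<subseteq> (*) (complex_of_real \<rho>) ` sphere 0 1"
    proof
      fix x :: complex assume "x \<in> sphere 0 \<rho>"
      then show "x \<in> (*) (of_real \<rho>) ` sphere 0 1"
        using \<rho> by (intro image_eqI[of _ _ "x / of_real \<rho>"]) (auto simp: norm_divide)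
    qed
  qed (use \<rho> in \<open>auto simp: norm_mult\<close>)
  then show "(\<lambda>w. \<Psi> (of_real \<rho> * w)) ` sphere 0 1 = frontier \<Omega>"
    using im by (metis image_image)
  show "\<Psi> (of_real \<rho> * w) \<notin> closure \<Omega>" if "1 < cmod w" "cmod w < \<kappa>" for w
    using out[of "of_real \<rho> * w"] that \<rho> by (simp add: norm_mult mult.commute)
qed (fact assms)+

theorem theorem2p9:
  fixes \<Omega> :: "complex set" and z0 :: complex and s :: real
    and f :: "complex \<Rightarrow> complex" and g h :: "complex \<Rightarrow> real"
    and \<Psi> :: "complex \<Rightarrow> complex" and \<rho> \<kappa> R :: real
  assumes "open \<Omega>" and "connected \<Omega>" and "bounded \<Omega>"
    and "analytic_jordan_curve (frontier \<Omega>)"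
    and "z0 \<in> \<Omega>"
    and "exact_functions \<Omega> z0 f g h"
    and "peripheral_conformal_map (frontier \<Omega>) \<rho> \<kappa> \<Psi>"
    and "\<And>z. \<rho> < cmod z \<Longrightarrow> cmod z \<le> \<kappa> * \<rho> \<Longrightarrow> \<Psi> z \<notin> closure \<Omega>"
    and "\<rho> < R" and "R < sqrt \<kappa> * \<rho>"
  shows "\<exists>C::real. C > 0 \<and>
    (\<forall>\<^sub>F N in sequentially. \<forall>Q. collocation_eqs \<Psi> \<rho> R z0 N Q \<longrightarrow>
       sobolev_norm \<Psi> \<rho> s (\<lambda>z. h z - dipole_h \<Psi> R z0 N Q z)
         \<le> ennreal C * sobolev_norm \<Psi> \<rho> s (\<lambda>z. g z - dipole_g \<Psi> R N Q z))"
proof -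
  interpret collar \<Omega> "\<lambda>w. \<Psi> (of_real \<rho> * w)" "1 / \<kappa>" \<kappa>
    using assms by (intro collar_of_peripheral_map)
  have \<rho>: "\<rho> > 0" and \<kappa>: "\<kappa> > 1"
    using assms(7) unfolding peripheral_conformal_map_def by auto
  let ?c = "\<lambda>u n. (cmod (circ_coeff (\<lambda>w. of_real (u (\<Psi> (of_real \<rho> * w)))) 1 n))\<^sup>2 * freq_weight n powr (2 * s)"
  have norm: "sobolev_norm \<Psi> \<rho> s u = (if ?c u summable_on UNIV then ennreal (sqrt (infsum (?c u) UNIV)) else \<infinity>)" for u
    unfolding sobolev_norm_def fourier_coeff_eq_circ_coeff Let_def ..
  obtain D where D: "D > 0" "\<And>F. F holomorphic_on \<Omega> \<Longrightarrow> continuous_on (closure \<Omega>) F \<Longrightarrow> Im (F z0) = 0 \<Longrightarrow>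
      ?c (\<lambda>z. Re (F z)) summable_on UNIV \<Longrightarrow>
      ?c (\<lambda>z. Im (F z)) summable_on UNIV \<and> infsum (?c (\<lambda>z. Im (F z))) UNIV \<le> D\<^sup>2 * infsum (?c (\<lambda>z. Re (F z))) UNIV"
    using conjugate_estimate[OF assms(5), of s] by blast
  have "sobolev_norm \<Psi> \<rho> s (\<lambda>z. h z - dipole_h \<Psi> R z0 N Q z)
         \<le> ennreal D * sobolev_norm \<Psi> \<rho> s (\<lambda>z. g z - dipole_g \<Psi> R N Q z)" for N Q
  proof -
    define P where "P z = (\<Sum>k=1..N. of_real (Q k) * dipole_moment \<Psi> R N k / (z - singular_pt \<Psi> R N k))" for z
    \<comment> \<open>The real and imaginary parts of \<open>F\<close> are the two errors. The added
      constant reproduces the normalization of \<open>dipole_h\<close>, and with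
      \<open>h z0 = 0\<close> it gives \<open>Im (F z0) = 0\<close>.\<close>
    define F where "F z = Complex (g z) (h z) - P z + \<i> * of_real (Im (P z0))" for z
    \<comment> \<open>This places the radius \<open>R\<close> in the range where \<Psi> maps outside
      the closure of \<Omega>, so all poles of \<open>P\<close> lie there.\<close>
    have "sqrt \<kappa> \<le> \<kappa>" using \<kappa> by (intro real_le_lsqrt) (auto simp: power2_eq_square)
    then have "R \<le> \<kappa> * \<rho>" using assms(10) \<rho> mult_right_mono[of "sqrt \<kappa>" \<kappa> \<rho>] by linarith
    then have sing: "singular_pt \<Psi> R N k \<notin> closure \<Omega>" for k
      unfolding singular_pt_def using assms(9) \<rho>
      by (intro assms(8)) (auto simp: norm_mult norm_power root_pt_def)
    have ReF: "Re (F z) = g z - dipole_g \<Psi> R N Q z" for z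
      by (simp add: F_def P_def dipole_g_def Re_sum flip: times_divide_eq_right)
    have ImF: "Im (F z) = h z - dipole_h \<Psi> R z0 N Q z" for z
      by (simp add: F_def P_def dipole_h_def dipole_h_tilde_def)
    have "P holomorphic_on \<Omega>" unfolding P_def
      using sing closure_subset[of \<Omega>] by (intro holomorphic_intros) auto
    then have F1: "F holomorphic_on \<Omega>" unfolding F_def
      using assms(6) by (auto simp: exact_functions_def intro!: holomorphic_intros)
    have "continuous_on (closure \<Omega>) P" unfolding P_def
      using sing by (intro continuous_intros) auto
    then have F2: "continuous_on (closure \<Omega>) F" unfolding F_def Complex_eq
      using assms(6) by (auto simp: exact_functions_def intro!: continuous_intros)
    have F3: "Im (F z0) = 0"
      using assms(6) by (simp add: F_def exact_functions_def)
    show ?thesis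
    proof (cases "?c (\<lambda>z. Re (F z)) summable_on UNIV")
      case True
      note b = D(2)[OF F1 F2 F3 True]
      have "sqrt (infsum (?c (\<lambda>z. Im (F z))) UNIV) \<le> D * sqrt (infsum (?c (\<lambda>z. Re (F z))) UNIV)"
        using real_sqrt_le_mono[OF conjunct2[OF b]] D(1) by (simp add: real_sqrt_mult)
      then show ?thesis using True conjunct1[OF b] D(1) unfolding norm ReF ImF
        by (auto simp flip: ennreal_mult' intro!: ennreal_leI)
    next
      \<comment> \<open>The norm on the right is infinite, and \<open>D > 0\<close> keeps the
        product infinite.\<close>
      case False
      then show ?thesis using D(1) unfolding norm ReF by (simp add: ennreal_mult_top)
    qed
  qed
  then show ?thesis using D(1) by (intro exI[of _ D]) auto
qed

end
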